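(* Let $E$ be a complex Banach lattice and let $(e^{tA})_{t\ge 0}$ be an individually eventually positive $C_0$-semigroup on $E$. If the semigroup is analytic, then the following five conditions are equivalent: (i) $(e^{tA})_{t\ge 0}$ is irreducible. (ii) For each $0\lneq f\in E$ and each $0\lneq\varphi\in E'$ there exists $t\in[0,\infty)$ such that $\langle\varphi,e^{tA}f\rangle\neq 0$. (iii) $(e^{tA})_{t\ge 0}$ is persistently irreducible. (iv) For each $0\lneq f\in E$, each $0\lneq\varphi\in E'$ and each $t_0\in[0,\infty)$ there exists $t\in\{0\}\cup[t_0,\infty)$ such that $\langle\varphi,e^{tA}f\rangle\neq 0$. (v) For each $0\lneq f\in E$, each $0\lneq\varphi\in E'$ and each $t_0\in[0,\infty)$ there exists $t\in[t_0,\infty)$ such that $\langle\varphi,e^{tA}f\rangle\neq 0$.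
   Context: Notation: $E_+$ is the positive cone; $f\gneq 0$ (or $0 \lneq f$) means $f\ge 0$ and $f\ne 0$; $E'$ is the dual Banach lattice. A $C_0$-semigroup $(e^{tA})_{t\ge0}$ on $E$ is individually eventually positive if for each $0\le f\in E$ there exists $t_0\ge 0$ such that $e^{tA}f\ge 0$ for all $t\ge t_0$. A $C_0$-semigroup $(e^{tA})_{t\ge0}$ on $E$ is irreducible if no closed ideal $I$ of $E$ other than $\{0\}$ and $E$ satisfies $e^{tA}I\subseteq I$ for all $t\ge 0$. It is persistently irreducible if no closed ideal $I$ other than $\{0\}$ and $E$ is uniformly eventually invariant, i.e. satisfies: there is $t_0\ge0$ with $e^{tA}I\subseteq I$ for all $t\ge t_0$. *)

theory Defs
  imports "HOL-Analysis.Analysis" "HOL-Library.Lattice_Algebras"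
begin

section \<open>Complex normed spaces\<close>

class scaleC =
  fixes scaleC :: "complex \<Rightarrow> 'a \<Rightarrow> 'a" (infixr \<open>*\<^sub>C\<close> 75)

class complex_normed_space = real_normed_vector + scaleC +
  assumes scaleC_add_right: "c *\<^sub>C (x + y) = c *\<^sub>C x + c *\<^sub>C y"
    and scaleC_add_left: "(c + d) *\<^sub>C x = c *\<^sub>C x + d *\<^sub>C x"
    and scaleC_scaleC: "c *\<^sub>C d *\<^sub>C x = (c * d) *\<^sub>C x"
    and scaleC_of_real: "complex_of_real r *\<^sub>C x = r *\<^sub>R x"
    and norm_scaleC: "norm (c *\<^sub>C x) = cmod c * norm x"

class complex_banach = complex_normed_space + banach

lemma bounded_linear_scaleC_right: "bounded_linear (\<lambda>x::'a::complex_normed_space. c *\<^sub>C x)"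
proof (rule bounded_linear_intro[where K = "cmod c"])
  fix x y :: 'a and r :: real
  show "c *\<^sub>C (x + y) = c *\<^sub>C x + c *\<^sub>C y" by (rule scaleC_add_right)
  show "c *\<^sub>C (r *\<^sub>R x) = r *\<^sub>R (c *\<^sub>C x)"
    by (metis scaleC_of_real scaleC_scaleC mult.commute)
  show "norm (c *\<^sub>C x) \<le> norm x * cmod c" by (simp add: norm_scaleC)
qed

instantiation complex :: complex_banach
begin
definition scaleC_complex :: "complex \<Rightarrow> complex \<Rightarrow> complex" where
  "c *\<^sub>C z = c * z"
instance
  by standard (auto simp: scaleC_complex_def algebra_simps norm_mult scaleR_conv_of_real)
end

text \<open>
  The library type \<open>'a \<Rightarrow>\<^sub>L 'b\<close> consists of the bounded \<^emph>\<open>real\<close>-linear maps. Those that are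
  complex-linear are singled out by the predicate \<open>clinear\<close>; on them the library norm
  is the operator norm of the complex theory.
\<close>

instantiation blinfun :: (real_normed_vector, complex_normed_space) complex_normed_space
begin
lift_definition scaleC_blinfun :: "complex \<Rightarrow> 'a \<Rightarrow>\<^sub>L 'b \<Rightarrow> 'a \<Rightarrow>\<^sub>L 'b"
  is "\<lambda>c f x. c *\<^sub>C f x"
  by (rule bounded_linear_compose[OF bounded_linear_scaleC_right])
instance
proof
  fix c d :: complex and r :: real and x y :: "'a \<Rightarrow>\<^sub>L 'b"
  show "c *\<^sub>C (x + y) = c *\<^sub>C x + c *\<^sub>C y" by transfer (simp add: scaleC_add_right)
  show "(c + d) *\<^sub>C x = c *\<^sub>C x + d *\<^sub>C x" by transfer (simp add: scaleC_add_left)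
  show "c *\<^sub>C d *\<^sub>C x = (c * d) *\<^sub>C x" by transfer (simp add: scaleC_scaleC)
  show "complex_of_real r *\<^sub>C x = r *\<^sub>R x" by transfer (simp add: scaleC_of_real)
  show "norm (c *\<^sub>C x) = cmod c * norm x"
  proof transfer
    fix c and f :: "'a \<Rightarrow> 'b"
    have "onorm (\<lambda>x. c *\<^sub>C f x) = onorm (\<lambda>x. cmod c *\<^sub>R f x)"
      by (simp add: onorm_def norm_scaleC)
    moreover assume "bounded_linear f"
    ultimately show "onorm (\<lambda>x. c *\<^sub>C f x) = cmod c * onorm f"
      by (simp add: onorm_scaleR)
  qed
qed
end

instance blinfun :: (real_normed_vector, complex_banach) complex_banach ..

definition clinear :: "('a::complex_normed_space \<Rightarrow>\<^sub>L 'b::complex_normed_space) \<Rightarrow> bool" where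
  "clinear T \<longleftrightarrow> (\<forall>c x. blinfun_apply T (c *\<^sub>C x) = c *\<^sub>C blinfun_apply T x)"

text \<open>Holomorphy of functions with values in a complex normed space (for values in
  \<open>'a \<Rightarrow>\<^sub>L 'b\<close>: with respect to the operator norm).\<close>

definition vholomorphic_on :: "(complex \<Rightarrow> 'a::complex_normed_space) \<Rightarrow> complex set \<Rightarrow> bool"
    (infixl \<open>vholomorphic'_on\<close> 50) where
  "F vholomorphic_on S \<longleftrightarrow>
     (\<forall>z\<in>S. \<exists>D. (F has_derivative (\<lambda>h. h *\<^sub>C D)) (at z within S))"


section \<open>Real Banach lattices\<close>

class banach_lattice = banach + ordered_real_vector + lattice_ab_group_add_abs +
  assumes norm_abs_mono: "\<bar>x\<bar> \<le> \<bar>y\<bar> \<Longrightarrow> norm x \<le> norm y"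

instance real :: banach_lattice
  by standard (auto simp: sup_real_def)

lemma bl_norm_abs: "norm \<bar>x\<bar> = norm (x::'a::banach_lattice)"
  by (intro order_antisym norm_abs_mono) simp_all

lemma bl_norm_mono: "0 \<le> x \<Longrightarrow> x \<le> y \<Longrightarrow> norm x \<le> norm (y::'a::banach_lattice)"
  by (rule norm_abs_mono) (simp add: order_trans[of 0 x y])

lemma bl_tendsto_nonneg:
  fixes x :: "nat \<Rightarrow> 'a::banach_lattice"
  assumes lim: "x \<longlonglongrightarrow> l" and nonneg: "\<And>n. 0 \<le> x n"
  shows "0 \<le> l"
proof -
  have *: "norm (sup 0 (- l)) \<le> norm (x n - l)" for n
  proof -
    have "- l \<le> x n - l" using nonneg[of n] by simp
    also have "\<dots> \<le> \<bar>x n - l\<bar>" by (rule abs_ge_self)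
    finally have "sup 0 (- l) \<le> \<bar>x n - l\<bar>" by simp
    then have "norm (sup 0 (- l)) \<le> norm \<bar>x n - l\<bar>" by (intro bl_norm_mono) simp_all
    then show ?thesis by (simp add: bl_norm_abs)
  qed
  have "(\<lambda>n. norm (x n - l)) \<longlonglongrightarrow> 0"
    using lim by (simp add: LIM_zero tendsto_norm_zero)
  then have "norm (sup 0 (- l)) \<le> 0"
    by (rule LIMSEQ_le_const) (use * in auto)
  then have "sup 0 (- l) = 0" by simp
  then have "- l \<le> 0" by (metis sup.cobounded2)
  then show ?thesis by simp
qed

lemma bl_tendsto_le:
  fixes x y :: "nat \<Rightarrow> 'a::banach_lattice"
  assumes "x \<longlonglongrightarrow> l" "y \<longlonglongrightarrow> m" "\<And>n. x n \<le> y n"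
  shows "l \<le> m"
proof -
  have "0 \<le> m - l"
    by (rule bl_tendsto_nonneg[OF tendsto_diff[OF assms(2,1)]]) (simp add: assms(3))
  then show ?thesis by simp
qed


section \<open>Complex Banach lattices\<close>

text \<open>
  A complex Banach lattice is the complexification \<open>E = E\<^sub>\<real> + i E\<^sub>\<real>\<close> of a real Banach
  lattice \<open>E\<^sub>\<real>\<close>, with modulus \<open>|z| = sup\<^sub>\<theta> Re (e\<^sup>i\<^sup>\<theta> z) \<in> E\<^sub>\<real>\<close> and
  norm \<open>\<parallel>z\<parallel> = \<parallel> |z| \<parallel>\<close>. Below, \<open>E\<^sub>\<real>\<close> is \<open>'a\<close> and \<open>E\<close> is \<open>'a complexification\<close>.
\<close>

datatype 'a complexification = Cplx (cre: 'a) (cim: 'a)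

lemma complexification_eq_iff: "z = w \<longleftrightarrow> cre z = cre w \<and> cim z = cim w"
  by (cases z; cases w) simp

instantiation complexification :: (real_vector) "{real_vector, scaleC}"
begin
definition "0 = Cplx 0 0"
definition "z + w = Cplx (cre z + cre w) (cim z + cim w)"
definition "z - w = Cplx (cre z - cre w) (cim z - cim w)"
definition "- z = Cplx (- cre z) (- cim z)"
definition "r *\<^sub>R z = Cplx (r *\<^sub>R cre z) (r *\<^sub>R cim z)"
definition scaleC_complexification :: "complex \<Rightarrow> 'a complexification \<Rightarrow> 'a complexification" where
  "c *\<^sub>C z = Cplx (Re c *\<^sub>R cre z - Im c *\<^sub>R cim z) (Im c *\<^sub>R cre z + Re c *\<^sub>R cim z)"
instance
  by standard
    (simp_all add: complexification_eq_iff zero_complexification_def plus_complexification_def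
      minus_complexification_def uminus_complexification_def scaleR_complexification_def algebra_simps)
end

lemma cre_cim_simps [simp]:
  "cre 0 = 0" "cim 0 = 0"
  "cre (z + w) = cre z + cre w" "cim (z + w) = cim z + cim w"
  "cre (z - w) = cre z - cre w" "cim (z - w) = cim z - cim w"
  "cre (- z) = - cre z" "cim (- z) = - cim z"
  "cre (r *\<^sub>R z) = r *\<^sub>R cre z" "cim (r *\<^sub>R z) = r *\<^sub>R cim z"
  "cre (c *\<^sub>C z) = Re c *\<^sub>R cre z - Im c *\<^sub>R cim z"
  "cim (c *\<^sub>C z) = Im c *\<^sub>R cre z + Re c *\<^sub>R cim z"
  by (simp_all add: zero_complexification_def plus_complexification_def minus_complexification_def
      uminus_complexification_def scaleR_complexification_def scaleC_complexification_def)

text \<open>The order on \<open>E\<close> is the one induced by the cone \<open>E\<^sub>+ \<subseteq> E\<^sub>\<real>\<close>: only differences that are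
  real and positive count as positive. In particular \<open>0 < f\<close> means \<open>f \<ge> 0\<close> and \<open>f \<noteq> 0\<close>.\<close>

instantiation complexification :: (ordered_real_vector) ordered_real_vector
begin
definition "z \<le> w \<longleftrightarrow> cim z = cim w \<and> cre z \<le> cre w"
definition "z < w \<longleftrightarrow> z \<le> w \<and> z \<noteq> (w::'a complexification)"
instance
  by standard
    (auto simp: less_eq_complexification_def less_complexification_def complexification_eq_iff
      scaleR_left_mono scaleR_right_mono)
end

definition is_modulus :: "'a::banach_lattice complexification \<Rightarrow> 'a \<Rightarrow> bool" where
  "is_modulus z s \<longleftrightarrow>
     (\<forall>\<theta>. cre (cis \<theta> *\<^sub>C z) \<le> s) \<and> (\<forall>u. (\<forall>\<theta>. cre (cis \<theta> *\<^sub>C z) \<le> u) \<longrightarrow> s \<le> u)"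

definition modulus :: "'a::banach_lattice complexification \<Rightarrow> 'a" where
  "modulus z = (THE s. is_modulus z s)"

lemma bl_scaleR_le_abs:
  fixes x :: "'a::banach_lattice"
  assumes "\<bar>r\<bar> \<le> d"
  shows "r *\<^sub>R x \<le> d *\<^sub>R \<bar>x\<bar>"
proof (cases "0 \<le> r")
  case True
  have "r *\<^sub>R x \<le> r *\<^sub>R \<bar>x\<bar>" using True by (intro scaleR_left_mono abs_ge_self)
  also have "\<dots> \<le> d *\<^sub>R \<bar>x\<bar>" using assms by (intro scaleR_right_mono) auto
  finally show ?thesis .
next
  case False
  have "r *\<^sub>R x = (- r) *\<^sub>R (- x)" by simp
  also have "\<dots> \<le> (- r) *\<^sub>R \<bar>x\<bar>" using False by (intro scaleR_left_mono abs_ge_minus_self) auto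
  also have "\<dots> \<le> d *\<^sub>R \<bar>x\<bar>" using assms by (intro scaleR_right_mono) auto
  finally show ?thesis .
qed

lemma cre_scaleC_le:
  fixes z :: "'a::banach_lattice complexification"
  assumes "cmod c \<le> d"
  shows "cre (c *\<^sub>C z) \<le> d *\<^sub>R (\<bar>cre z\<bar> + \<bar>cim z\<bar>)"
proof -
  have "Re c *\<^sub>R cre z \<le> d *\<^sub>R \<bar>cre z\<bar>"
    using assms abs_Re_le_cmod[of c] by (intro bl_scaleR_le_abs) linarith
  moreover have "(- Im c) *\<^sub>R cim z \<le> d *\<^sub>R \<bar>cim z\<bar>"
    using assms abs_Im_le_cmod[of c] by (intro bl_scaleR_le_abs) linarith
  ultimately show ?thesis
    using add_mono[of "Re c *\<^sub>R cre z" "d *\<^sub>R \<bar>cre z\<bar>" "(- Im c) *\<^sub>R cim z" "d *\<^sub>R \<bar>cim z\<bar>"]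
    by (simp add: scaleR_add_right)
qed

lemma ex_modulus: "\<exists>s. is_modulus (z::'a::banach_lattice complexification) s"
proof -
  define u where "u c = cre (c *\<^sub>C z)" for c
  define w where "w = \<bar>cre z\<bar> + \<bar>cim z\<bar>"
  have w0: "0 \<le> w" by (simp add: w_def)
  define \<delta> where "\<delta> n = 1 / real (Suc n)" for n
  have \<delta>0: "0 < \<delta> n" for n by (simp add: \<delta>_def)
  have "\<exists>k. finite k \<and> k \<subseteq> sphere (0::complex) 1 \<and> sphere 0 1 \<subseteq> (\<Union>x\<in>k. ball x (\<delta> n))" for n
    using seq_compact_imp_totally_bounded[of "sphere (0::complex) 1"] \<delta>0
    by (meson compact_imp_seq_compact compact_sphere)
  then obtain K where K: "\<And>n. finite (K n)" "\<And>n. K n \<subseteq> sphere 0 1"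
      "\<And>n. sphere (0::complex) 1 \<subseteq> (\<Union>x\<in>K n. ball x (\<delta> n))"
    by metis
  have Kne: "K n \<noteq> {}" for n
  proof -
    have "(1::complex) \<in> sphere 0 1" by simp
    then show ?thesis using K(3)[of n] by blast
  qed
  define s where "s n = Sup_fin (u ` K n)" for n
  have us: "u c \<le> s n + \<delta> n *\<^sub>R w" if "cmod c = 1" for c n
  proof -
    have "c \<in> (\<Union>x\<in>K n. ball x (\<delta> n))" using that K(3)[of n] by (auto simp: subset_iff)
    then obtain d where d: "d \<in> K n" "cmod (c - d) \<le> \<delta> n"
      by (auto simp: dist_norm norm_minus_commute less_imp_le)
    have "u c = u d + u (c - d)" by (simp add: u_def algebra_simps)
    also have "u d \<le> s n" unfolding s_def using d K Kne
      by (intro Sup_fin.coboundedI) auto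
    also have "u (c - d) \<le> \<delta> n *\<^sub>R w" unfolding u_def w_def by (rule cre_scaleC_le[OF d(2)])
    finally show ?thesis by simp
  qed
  have s_le: "s n \<le> b" if "\<And>c. cmod c = 1 \<Longrightarrow> u c \<le> b" for b n
    unfolding s_def using K Kne that by (intro Sup_fin.boundedI) (auto simp: subset_iff)
  have diff: "norm (s m - s n) \<le> (\<delta> m + \<delta> n) * norm w" for m n
  proof -
    have 1: "s m - s n \<le> (\<delta> m + \<delta> n) *\<^sub>R w" for m n
    proof -
      have "s m \<le> s n + \<delta> n *\<^sub>R w" by (rule s_le) (rule us)
      then have "s m - s n \<le> \<delta> n *\<^sub>R w" by (simp add: diff_le_eq add.commute)
      also have "\<dots> \<le> (\<delta> m + \<delta> n) *\<^sub>R w"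
        using \<delta>0[of m] w0 by (intro scaleR_right_mono) auto
      finally show ?thesis .
    qed
    have "\<bar>s m - s n\<bar> \<le> (\<delta> m + \<delta> n) *\<^sub>R w"
      using 1[of m n] 1[of n m] by (intro abs_leI) (simp_all add: add.commute)
    then have "norm \<bar>s m - s n\<bar> \<le> norm ((\<delta> m + \<delta> n) *\<^sub>R w)"
      by (intro bl_norm_mono) simp_all
    then show ?thesis using \<delta>0[of m] \<delta>0[of n] by (simp add: bl_norm_abs)
  qed
  have \<delta>lim: "\<delta> \<longlonglongrightarrow> 0"
    unfolding \<delta>_def by (rule LIMSEQ_Suc[OF lim_1_over_n])
  have "Cauchy s"
  proof (rule metric_CauchyI)
    fix e :: real assume "0 < e"
    have "(\<lambda>n. \<delta> n * norm w) \<longlonglongrightarrow> 0 * norm w" by (intro tendsto_intros \<delta>lim)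
    then have "eventually (\<lambda>n. \<delta> n * norm w < e / 2) sequentially"
      using \<open>0 < e\<close> by (intro order_tendstoD) auto
    then obtain N where N: "\<And>n. n \<ge> N \<Longrightarrow> \<delta> n * norm w < e / 2"
      by (auto simp: eventually_sequentially)
    have "dist (s m) (s n) < e" if "m \<ge> N" "n \<ge> N" for m n
      using diff[of m n] N[OF that(1)] N[OF that(2)] by (simp add: dist_norm distrib_right)
    then show "\<exists>M. \<forall>m\<ge>M. \<forall>n\<ge>M. dist (s m) (s n) < e" by blast
  qed
  then obtain l where l: "s \<longlonglongrightarrow> l" using Cauchy_convergent convergent_def by blast
  have ub: "u c \<le> l" if "cmod c = 1" for c
  proof -
    have "(\<lambda>n. s n + \<delta> n *\<^sub>R w) \<longlonglongrightarrow> l + 0 *\<^sub>R w" by (intro tendsto_intros l \<delta>lim)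
    then show ?thesis
      using bl_tendsto_le[OF tendsto_const, of _ _ "u c"] us[OF that] by fastforce
  qed
  have lub: "l \<le> b" if b: "\<forall>\<theta>. u (cis \<theta>) \<le> b" for b
  proof (rule bl_tendsto_le[OF l tendsto_const], rule s_le)
    fix c :: complex assume "cmod c = 1"
    then have "c = cis (Arg c)" by (metis Arg_eq cis_conv_exp mult_1 of_real_1 norm_zero zero_neq_one)
    then show "u c \<le> b" using b by metis
  qed
  have "is_modulus z l" unfolding is_modulus_def u_def[symmetric] using ub lub norm_cis by blast
  then show ?thesis ..
qed

lemma is_modulus_modulus: "is_modulus z (modulus z)"
proof -
  obtain s where s: "is_modulus z s" using ex_modulus by blast
  show ?thesis unfolding modulus_def
    by (rule theI[of _ s]) (use s in \<open>auto simp: is_modulus_def intro!: order_antisym\<close>)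
qed

lemma cre_cis_le_modulus: "cre (cis \<theta> *\<^sub>C z) \<le> modulus z"
  using is_modulus_modulus[of z] by (simp only: is_modulus_def)

lemma modulus_least: "(\<And>\<theta>. cre (cis \<theta> *\<^sub>C z) \<le> u) \<Longrightarrow> modulus z \<le> u"
  using is_modulus_modulus[of z] unfolding is_modulus_def by blast

lemma abs_cre_le_modulus: "\<bar>cre z\<bar> \<le> modulus z"
  using cre_cis_le_modulus[of 0 z] cre_cis_le_modulus[of pi z]
  by (intro abs_leI) simp_all

lemma abs_cim_le_modulus: "\<bar>cim z\<bar> \<le> modulus z"
  using cre_cis_le_modulus[of "pi / 2" z] cre_cis_le_modulus[of "- (pi / 2)" z]
  by (intro abs_leI) simp_all

lemma modulus_nonneg: "0 \<le> modulus z"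
  using abs_cre_le_modulus[of z] abs_ge_zero order_trans by blast

lemma modulus_le: "modulus z \<le> \<bar>cre z\<bar> + \<bar>cim z\<bar>"
  by (rule modulus_least) (metis cre_scaleC_le norm_cis order_refl scaleR_one)

lemma modulus_add: "modulus (z + w) \<le> modulus z + modulus w"
proof (rule modulus_least)
  fix \<theta>
  have "cre (cis \<theta> *\<^sub>C (z + w)) = cre (cis \<theta> *\<^sub>C z) + cre (cis \<theta> *\<^sub>C w)"
    by (simp add: algebra_simps)
  then show "cre (cis \<theta> *\<^sub>C (z + w)) \<le> modulus z + modulus w"
    by (metis add_mono cre_cis_le_modulus)
qed

lemma modulus_scaleC_le: "modulus (c *\<^sub>C z) \<le> cmod c *\<^sub>R modulus z"
proof (rule modulus_least)
  fix \<theta>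
  have c: "c = cmod c *\<^sub>R cis (Arg c)"
    by (cases "c = 0") (simp_all add: Arg_eq cis_conv_exp scaleR_conv_of_real)
  have "cre (cis \<theta> *\<^sub>C c *\<^sub>C z) = cre ((cis \<theta> * c) *\<^sub>C z)" by (simp add: algebra_simps)
  also have "cis \<theta> * c = cmod c *\<^sub>R cis (\<theta> + Arg c)"
    by (subst c) (simp add: cis_mult)
  also have "cre ((cmod c *\<^sub>R cis (\<theta> + Arg c)) *\<^sub>C z) = cmod c *\<^sub>R cre (cis (\<theta> + Arg c) *\<^sub>C z)"
    by (simp add: algebra_simps)
  also have "\<dots> \<le> cmod c *\<^sub>R modulus z"
    by (intro scaleR_left_mono cre_cis_le_modulus) simp
  finally show "cre (cis \<theta> *\<^sub>C c *\<^sub>C z) \<le> cmod c *\<^sub>R modulus z" .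
qed

instantiation complexification :: (banach_lattice) complex_normed_space
begin

definition norm_complexification :: "'a complexification \<Rightarrow> real" where
  "norm_complexification z = norm (modulus z)"
definition sgn_complexification :: "'a complexification \<Rightarrow> 'a complexification" where
  "sgn_complexification z = z /\<^sub>R norm z"
definition dist_complexification :: "'a complexification \<Rightarrow> 'a complexification \<Rightarrow> real" where
  "dist_complexification z w = norm (z - w)"
definition uniformity_complexification :: "('a complexification \<times> 'a complexification) filter" where
  "uniformity_complexification = (INF e\<in>{0 <..}. principal {(x, y). dist x y < e})"
definition open_complexification :: "'a complexification set \<Rightarrow> bool" where
  "open_complexification U \<longleftrightarrow> (\<forall>x\<in>U. eventually (\<lambda>(x', y). x' = x \<longrightarrow> y \<in> U) uniformity)"

lemma norm_cre_le: "norm (cre z) \<le> norm z"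
  and norm_cim_le: "norm (cim z) \<le> norm z"
  and norm_complexification_le: "norm z \<le> norm (cre z) + norm (cim z)"
  for z :: "'a complexification"
proof -
  have "norm \<bar>cre z\<bar> \<le> norm z" "norm \<bar>cim z\<bar> \<le> norm z"
    unfolding norm_complexification_def
    by (intro bl_norm_mono abs_ge_zero abs_cre_le_modulus abs_cim_le_modulus)+
  then show "norm (cre z) \<le> norm z" "norm (cim z) \<le> norm z" by (simp_all add: bl_norm_abs)
  have "norm z \<le> norm (\<bar>cre z\<bar> + \<bar>cim z\<bar>)"
    unfolding norm_complexification_def by (intro bl_norm_mono modulus_nonneg modulus_le)
  also have "\<dots> \<le> norm (cre z) + norm (cim z)"
    by (metis norm_triangle_ineq bl_norm_abs)
  finally show "norm z \<le> norm (cre z) + norm (cim z)" .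
qed

lemma norm_scaleC_complexification: "norm (c *\<^sub>C z) = cmod c * norm z"
  for z :: "'a complexification"
proof (rule order_antisym)
  have le: "norm (c *\<^sub>C z) \<le> cmod c * norm z" for c and z :: "'a complexification"
    using bl_norm_mono[OF modulus_nonneg modulus_scaleC_le[of c z]]
    by (simp add: norm_complexification_def)
  show "norm (c *\<^sub>C z) \<le> cmod c * norm z" by (rule le)
  show "cmod c * norm z \<le> norm (c *\<^sub>C z)"
  proof (cases "c = 0")
    case True
    then show ?thesis by (simp add: norm_complexification_def)
  next
    case False
    have "inverse c *\<^sub>C c *\<^sub>C z = (inverse c * c) *\<^sub>C z"
      unfolding complexification_eq_iff by (simp add: algebra_simps)
    also have "\<dots> = z" using False by (simp add: complexification_eq_iff)
    finally have "norm z \<le> norm (inverse c) * norm (c *\<^sub>C z)" using le[of "inverse c" "c *\<^sub>C z"] by simp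
    then have "cmod c * norm z \<le> cmod c * (norm (inverse c) * norm (c *\<^sub>C z))"
      by (intro mult_left_mono) simp_all
    also have "\<dots> = norm (c *\<^sub>C z)" using False by (simp add: norm_inverse)
    finally show ?thesis .
  qed
qed

instance
proof
  fix x y z :: "'a complexification" and r :: real and c d :: complex
    and U :: "'a complexification set"
  show "sgn x = x /\<^sub>R norm x" by (rule sgn_complexification_def)
  show "dist x y = norm (x - y)" by (rule dist_complexification_def)
  show "(uniformity :: ('a complexification \<times> 'a complexification) filter)
      = (INF e\<in>{0 <..}. principal {(x, y). dist x y < e})"
    by (rule uniformity_complexification_def)
  show "open U \<longleftrightarrow> (\<forall>x\<in>U. eventually (\<lambda>(x', y). x' = x \<longrightarrow> y \<in> U) uniformity)"
    by (rule open_complexification_def)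
  show "norm x = 0 \<longleftrightarrow> x = 0"
  proof
    assume "norm x = 0"
    then have "norm (cre x) \<le> 0" "norm (cim x) \<le> 0"
      using norm_cre_le[of x] norm_cim_le[of x] by simp_all
    then show "x = 0" by (simp add: complexification_eq_iff)
  next
    assume "x = 0"
    then have "norm x \<le> 0" using norm_complexification_le[of x] by simp
    then show "norm x = 0" by (simp add: norm_complexification_def)
  qed
  show "norm (x + y) \<le> norm x + norm y"
  proof -
    have "norm (x + y) \<le> norm (modulus x + modulus y)"
      unfolding norm_complexification_def by (intro bl_norm_mono modulus_nonneg modulus_add)
    also have "\<dots> \<le> norm x + norm y"
      unfolding norm_complexification_def by (rule norm_triangle_ineq)
    finally show ?thesis .
  qed
  have of_real: "complex_of_real r *\<^sub>C x = r *\<^sub>R x" for r and x :: "'a complexification"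
    by (simp add: complexification_eq_iff)
  show "complex_of_real r *\<^sub>C x = r *\<^sub>R x" by (rule of_real)
  show "norm (r *\<^sub>R x) = \<bar>r\<bar> * norm x"
    using norm_scaleC_complexification[of "complex_of_real r" x] by (simp add: of_real)
  show "norm (c *\<^sub>C x) = cmod c * norm x" by (rule norm_scaleC_complexification)
  show "c *\<^sub>C (x + y) = c *\<^sub>C x + c *\<^sub>C y" "(c + d) *\<^sub>C x = c *\<^sub>C x + d *\<^sub>C x"
    "c *\<^sub>C d *\<^sub>C x = (c * d) *\<^sub>C x"
    by (simp_all add: complexification_eq_iff algebra_simps)
qed

end

instance complexification :: (banach_lattice) complex_banach
proof
  fix X :: "nat \<Rightarrow> 'a complexification"
  assume X: "Cauchy X"
  have part: "Cauchy (\<lambda>n. p (X n))"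
    if "\<And>z w. norm (p z - p w) \<le> dist z w" for p :: "'a complexification \<Rightarrow> 'a"
    using X that unfolding Cauchy_def dist_norm[where 'a = 'a] by (meson order_le_less_trans)
  have "Cauchy (\<lambda>n. cre (X n))"
    by (rule part) (metis dist_norm norm_cre_le cre_cim_simps(5))
  moreover have "Cauchy (\<lambda>n. cim (X n))"
    by (rule part) (metis dist_norm norm_cim_le cre_cim_simps(6))
  ultimately obtain a b where ab: "(\<lambda>n. cre (X n)) \<longlonglongrightarrow> a" "(\<lambda>n. cim (X n)) \<longlonglongrightarrow> b"
    by (meson Cauchy_convergent convergent_def)
  have "(\<lambda>n. norm (cre (X n) - a) + norm (cim (X n) - b)) \<longlonglongrightarrow> 0 + 0"
    by (intro tendsto_add tendsto_norm_zero LIM_zero ab)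
  then have 0: "(\<lambda>n. norm (cre (X n) - a) + norm (cim (X n) - b)) \<longlonglongrightarrow> 0" by simp
  have "\<exists>N. \<forall>n\<ge>N. dist (X n) (Cplx a b) < e" if e: "e > 0" for e
  proof -
    obtain N where N: "\<forall>n\<ge>N. norm (cre (X n) - a) + norm (cim (X n) - b) < e"
      using order_tendstoD(2)[OF 0 e] by (auto simp: eventually_sequentially)
    have "dist (X n) (Cplx a b) < e" if "n \<ge> N" for n
      using N that norm_complexification_le[of "X n - Cplx a b"] by (force simp: dist_norm)
    then show ?thesis by blast
  qed
  then have "X \<longlonglongrightarrow> Cplx a b" by (simp add: lim_sequentially)
  then show "convergent X" by (rule convergentI)
qed

text \<open>The modulus, regarded as an element of \<open>E\<close> again.\<close>

instantiation complexification :: (banach_lattice) abs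
begin
definition abs_complexification :: "'a complexification \<Rightarrow> 'a complexification" where
  "\<bar>z\<bar> = Cplx (modulus z) 0"
instance ..
end

definition closed_ideal :: "'a::banach_lattice complexification set \<Rightarrow> bool" where
  "closed_ideal I \<longleftrightarrow> closed I \<and> 0 \<in> I \<and> (\<forall>f\<in>I. \<forall>g\<in>I. f + g \<in> I) \<and>
     (\<forall>c. \<forall>f\<in>I. c *\<^sub>C f \<in> I) \<and> (\<forall>f. \<forall>g\<in>I. \<bar>f\<bar> \<le> \<bar>g\<bar> \<longrightarrow> f \<in> I)"

text \<open>Positivity in the dual Banach lattice \<open>E'\<close>, whose elements are the \<open>\<phi> :: E \<Rightarrow>\<^sub>L complex\<close>
  with \<open>clinear \<phi>\<close>.\<close>

definition dual_nonneg :: "('a::banach_lattice complexification \<Rightarrow>\<^sub>L complex) \<Rightarrow> bool" where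
  "dual_nonneg \<phi> \<longleftrightarrow> clinear \<phi> \<and> (\<forall>f\<ge>0. blinfun_apply \<phi> f \<in> \<real>\<^sub>\<ge>\<^sub>0)"


section \<open>Semigroups\<close>

text \<open>A semigroup \<open>(e\<^sup>t\<^sup>A)\<^sub>t\<^sub>\<ge>\<^sub>0\<close> is a function \<open>T\<close> on the reals; its values at negative
  arguments are irrelevant.\<close>

definition C0_semigroup :: "(real \<Rightarrow> 'b::complex_banach \<Rightarrow>\<^sub>L 'b) \<Rightarrow> bool" where
  "C0_semigroup T \<longleftrightarrow>
     (\<forall>t\<ge>0. clinear (T t)) \<and>
     T 0 = id_blinfun \<and>
     (\<forall>s\<ge>0. \<forall>t\<ge>0. T (s + t) = T s o\<^sub>L T t) \<and>
     (\<forall>f. ((\<lambda>t. blinfun_apply (T t) f) \<longlongrightarrow> f) (at_right 0))"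

definition sector :: "real \<Rightarrow> complex set" where
  "sector \<delta> = {z. z \<noteq> 0 \<and> \<bar>Arg z\<bar> < \<delta>}"

text \<open>Analytic semigroups in the usual sense (not necessarily bounded ones): some holomorphic
  extension to a sector is a semigroup that is strongly continuous at \<open>0\<close> on smaller sectors.\<close>

definition analytic_semigroup :: "(real \<Rightarrow> 'b::complex_banach \<Rightarrow>\<^sub>L 'b) \<Rightarrow> bool" where
  "analytic_semigroup T \<longleftrightarrow> C0_semigroup T \<and>
     (\<exists>\<delta> S. 0 < \<delta> \<and> \<delta> \<le> pi / 2 \<and>
        (\<forall>t\<ge>0. S (complex_of_real t) = T t) \<and>
        (\<forall>z\<in>sector \<delta>. clinear (S z)) \<and>
        (\<forall>z\<in>sector \<delta>. \<forall>w\<in>sector \<delta>. S (z + w) = S z o\<^sub>L S w) \<and>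
        S vholomorphic_on sector \<delta> \<and>
        (\<forall>\<delta>'. 0 < \<delta>' \<and> \<delta>' < \<delta> \<longrightarrow>
           (\<forall>f. ((\<lambda>z. blinfun_apply (S z) f) \<longlongrightarrow> f) (at 0 within sector \<delta>'))))"

definition individually_eventually_positive ::
    "(real \<Rightarrow> 'a::banach_lattice complexification \<Rightarrow>\<^sub>L 'a complexification) \<Rightarrow> bool" where
  "individually_eventually_positive T \<longleftrightarrow>
     (\<forall>f\<ge>0. \<exists>t0\<ge>0. \<forall>t\<ge>t0. blinfun_apply (T t) f \<ge> 0)"

definition irreducible_semigroup ::
    "(real \<Rightarrow> 'a::banach_lattice complexification \<Rightarrow>\<^sub>L 'a complexification) \<Rightarrow> bool" where
  "irreducible_semigroup T \<longleftrightarrow>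
     (\<forall>I. closed_ideal I \<and> (\<forall>t\<ge>0. blinfun_apply (T t) ` I \<subseteq> I) \<longrightarrow> I = {0} \<or> I = UNIV)"

definition persistently_irreducible_semigroup ::
    "(real \<Rightarrow> 'a::banach_lattice complexification \<Rightarrow>\<^sub>L 'a complexification) \<Rightarrow> bool" where
  "persistently_irreducible_semigroup T \<longleftrightarrow>
     (\<forall>I. closed_ideal I \<and> (\<exists>t0\<ge>0. \<forall>t\<ge>t0. blinfun_apply (T t) ` I \<subseteq> I) \<longrightarrow>
        I = {0} \<or> I = UNIV)"

end

theory Submission
  imports Defs "HOL-Complex_Analysis.Conformal_Mappings"
begin

text \<open>
  For a functional \<open>\<phi>\<close> the map \<open>z \<mapsto> \<langle>\<phi>, e\<^sup>z\<^sup>A f\<rangle>\<close> is holomorphic on a sector, so it vanishes for all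
  times as soon as it vanishes for all large times. Hence (ii), (iv) and (v) are equivalent, and, by
  Hahn-Banach, a closed subspace that eventually contains an orbit contains all of it, which gives
  (i) \<open>\<Leftrightarrow>\<close> (iii). If (ii) holds, an invariant closed ideal is trivial because a proper closed ideal is
  annihilated by some positive functional \<open>\<phi> \<noteq> 0\<close>. Conversely, if (ii) fails for \<open>\<phi>\<close>, then
  \<open>{f. \<langle>\<phi>, e\<^sup>t\<^sup>A |f|\<rangle> = 0 for all t \<ge> 0}\<close> is a nontrivial invariant closed ideal: eventual
  positivity gives solidity and invariance for large times, and analyticity extends both to all times.
\<close>

section \<open>Dominated linear functionals\<close>

text \<open>Homogeneity is asked only as an inequality, which is what infima give directly; equality
  is recovered in \<open>sublinear_scaleR\<close>.\<close>

definition sublinear :: "('v::real_vector \<Rightarrow> real) \<Rightarrow> bool" where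
  "sublinear p \<longleftrightarrow> (\<forall>x y. p (x + y) \<le> p x + p y) \<and> (\<forall>r\<ge>0. \<forall>x. p (r *\<^sub>R x) \<le> r * p x)"

lemma sublinear_add: "sublinear p \<Longrightarrow> p (x + y) \<le> p x + p y"
  by (simp add: sublinear_def)

lemma sublinear_scaleR_le: "sublinear p \<Longrightarrow> 0 \<le> r \<Longrightarrow> p (r *\<^sub>R x) \<le> r * p x"
  by (simp add: sublinear_def)

lemma sublinear_zero:
  assumes "sublinear p" shows "p 0 = 0"
  using sublinear_add[OF assms, of 0 0] sublinear_scaleR_le[OF assms, of 0 0] by simp

text \<open>Gives the lower bound that keeps the infimum over a chain of sublinear functionals
  finite.\<close>

lemma sublinear_minus_ge:
  assumes "sublinear p" shows "- p (- x) \<le> p x"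
  using sublinear_add[OF assms, of x "- x"] sublinear_zero[OF assms] by simp

lemma sublinear_scaleR:
  assumes "sublinear p" "0 \<le> r" shows "p (r *\<^sub>R x) = r * p x"
proof (cases "r = 0")
  case True
  then show ?thesis using sublinear_zero[OF assms(1)] by simp
next
  case False
  \<comment> \<open>The converse inequality is the assumed one for the factor \<open>1 / r\<close>,
    applied to the scaled vector.\<close>
  then have "p ((1 / r) *\<^sub>R r *\<^sub>R x) \<le> (1 / r) * p (r *\<^sub>R x)"
    using assms by (intro sublinear_scaleR_le) auto
  then have "r * p x \<le> p (r *\<^sub>R x)" using False assms(2) by (simp add: field_simps)
  then show ?thesis using sublinear_scaleR_le[OF assms] by (simp add: order_antisym)
qed

text \<open>Lowers \<open>p\<close> as far as sublinearity allows while keeping its value at \<open>y\<close>: the tilted functional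
  is \<open>- p y\<close> at \<open>- y\<close>, so \<open>p\<close> can be minimal only if it is additive.\<close>

definition tilt :: "('v::real_vector \<Rightarrow> real) \<Rightarrow> 'v \<Rightarrow> 'v \<Rightarrow> real" where
  "tilt p y x = (INF t\<in>{0..}. p (x + t *\<^sub>R y) - t * p y)"

context
  fixes p :: "'v::real_vector \<Rightarrow> real"
  assumes p: "sublinear p"
begin

text \<open>The infimum is finite because \<open>t * p y\<close> is the value of \<open>p\<close> at
  \<open>t\<close> times \<open>y\<close>, hence at most
  \<open>p (x + t *\<^sub>R y) + p (- x)\<close>.\<close>

lemma tilt_le: "0 \<le> t \<Longrightarrow> tilt p y x \<le> p (x + t *\<^sub>R y) - t * p y"
  unfolding tilt_def
proof (intro cINF_lower bdd_belowI2)
  fix t :: real assume "t \<in> {0..}"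
  then show "- p (- x) \<le> p (x + t *\<^sub>R y) - t * p y"
    using sublinear_add[OF p, of "x + t *\<^sub>R y" "- x"] sublinear_scaleR[OF p, of t y] by simp
qed simp

lemma tilt_greatest: "(\<And>t. 0 \<le> t \<Longrightarrow> m \<le> p (x + t *\<^sub>R y) - t * p y) \<Longrightarrow> m \<le> tilt p y x"
  unfolding tilt_def by (intro cINF_greatest) auto

lemma tilt_le_self: "tilt p y x \<le> p x"
  using tilt_le[of 0] by simp

text \<open>Indices \<open>s\<close> for \<open>x\<close> and \<open>t\<close> for \<open>x'\<close>
  combine to the index \<open>s + t\<close> for the sum; the index \<open>t\<close> for
  \<open>x\<close> becomes \<open>r * t\<close> for its multiple by \<open>r\<close>. Infima are
  then taken one variable at a time.\<close>

lemma sublinear_tilt: "sublinear (tilt p y)"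
  unfolding sublinear_def
proof (intro conjI allI impI)
  fix x x'
  have "tilt p y (x + x') - (p (x' + t *\<^sub>R y) - t * p y) \<le> tilt p y x" if t: "0 \<le> t" for t
  proof (rule tilt_greatest)
    fix s :: real assume s: "0 \<le> s"
    have eq: "x + x' + (s + t) *\<^sub>R y = (x + s *\<^sub>R y) + (x' + t *\<^sub>R y)" by (simp add: algebra_simps)
    have "tilt p y (x + x') \<le> p (x + x' + (s + t) *\<^sub>R y) - (s + t) * p y"
      using s t by (intro tilt_le) simp
    also have "\<dots> \<le> p (x + s *\<^sub>R y) + p (x' + t *\<^sub>R y) - (s + t) * p y"
      unfolding eq using sublinear_add[OF p] by (intro diff_right_mono)
    finally show "tilt p y (x + x') - (p (x' + t *\<^sub>R y) - t * p y) \<le> p (x + s *\<^sub>R y) - s * p y"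
      by (simp add: algebra_simps)
  qed
  then have "tilt p y (x + x') - tilt p y x \<le> tilt p y x'"
    by (intro tilt_greatest) (simp add: algebra_simps)
  then show "tilt p y (x + x') \<le> tilt p y x + tilt p y x'" by simp
next
  fix r :: real and x assume r: "0 \<le> r"
  have *: "tilt p y (r *\<^sub>R x) \<le> r * (p (x + t *\<^sub>R y) - t * p y)" if t: "0 \<le> t" for t
  proof -
    have "tilt p y (r *\<^sub>R x) \<le> p (r *\<^sub>R x + (r * t) *\<^sub>R y) - (r * t) * p y"
      using r t by (intro tilt_le) simp
    also have "r *\<^sub>R x + (r * t) *\<^sub>R y = r *\<^sub>R (x + t *\<^sub>R y)" by (simp add: algebra_simps)
    finally show ?thesis
      using sublinear_scaleR[OF p r, of "x + t *\<^sub>R y"] by (simp add: right_diff_distrib)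
  qed
  show "tilt p y (r *\<^sub>R x) \<le> r * tilt p y x"
  proof (cases "r = 0")
    case True
    then show ?thesis using *[of 0] by simp
  next
    case False
    then have "tilt p y (r *\<^sub>R x) / r \<le> tilt p y x"
      using * r by (intro tilt_greatest) (simp add: field_simps)
    then show ?thesis using False r by (simp add: field_simps)
  qed
qed

end

section \<open>Minimal sublinear functionals and the Hahn-Banach theorem\<close>

lemma ex_minimal_sublinear:
  fixes p :: "'v::real_vector \<Rightarrow> real"
  assumes p: "sublinear p"
  obtains q where "sublinear q" "q \<le> p" "\<And>r. sublinear r \<Longrightarrow> r \<le> q \<Longrightarrow> r = q"
proof -
  define A where "A = {q. sublinear q \<and> q \<le> p}"
  have "\<exists>m\<in>A. \<forall>a\<in>A. a \<le> m \<longrightarrow> a = m"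
  \<comment> \<open>The order is reversed because Zorn's lemma yields maximal elements. A nonempty
    chain is bounded by its pointwise infimum, the empty one by \<open>p\<close>.\<close>
  proof (rule predicate_Zorn[of A "\<lambda>a b. b \<le> a"])
    show "partial_order_on A (relation_of (\<lambda>a b. b \<le> a) A)"
      by (rule partial_order_on_relation_ofI) auto
  next
    fix C assume "C \<in> Chains (relation_of (\<lambda>a b. b \<le> a) A)"
    then have CA: "C \<subseteq> A" and chain: "\<And>a b. a \<in> C \<Longrightarrow> b \<in> C \<Longrightarrow> a \<le> b \<or> b \<le> a"
      by (auto simp: Chains_def relation_of_def)
    show "\<exists>u\<in>A. \<forall>a\<in>C. u \<le> a"
    proof (cases "C = {}")
      case True
      then show ?thesis using p by (auto simp: A_def)
    next
      case False
      define u where "u x = (INF q\<in>C. q x)" for x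
      have u_le: "u x \<le> q x" if "q \<in> C" for q x
        unfolding u_def
      proof (intro cINF_lower that bdd_belowI2)
        fix q assume "q \<in> C"
        then have "sublinear q" "q (- x) \<le> p (- x)" using CA by (auto simp: A_def le_fun_def)
        then show "- p (- x) \<le> q x" using sublinear_minus_ge[of q x] by linarith
      qed
      have u_ge: "m \<le> u x" if "\<And>q. q \<in> C \<Longrightarrow> m \<le> q x" for m x
        unfolding u_def using False that by (intro cINF_greatest)
      \<comment> \<open>Members of a chain are comparable, so the smaller of \<open>q\<close> and
        \<open>q'\<close> can serve both arguments. This lets the two infima be taken
        independently.\<close>
      have add: "u (x + y) \<le> q x + q' y" if q: "q \<in> C" "q' \<in> C" for q q' x y
      proof -
        have q'': "u (x + y) \<le> r x + r y" if "r \<in> C" for r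
        proof -
          have "sublinear r" using that CA by (auto simp: A_def)
          then show ?thesis using u_le[OF that, of "x + y"] sublinear_add[of r x y] by linarith
        qed
        show ?thesis
          using chain[OF q]
        proof
          assume "q \<le> q'"
          then show ?thesis using q''[OF q(1)] le_funD[of q q' y] by linarith
        next
          assume "q' \<le> q"
          then show ?thesis using q''[OF q(2)] le_funD[of q' q x] by linarith
        qed
      qed
      have "u (x + y) \<le> u x + u y" for x y
      proof -
        have "u (x + y) - q' y \<le> u x" if "q' \<in> C" for q'
          using add[OF _ that] by (intro u_ge) (simp add: algebra_simps)
        then have "u (x + y) - u x \<le> u y" by (intro u_ge) (simp add: algebra_simps)
        then show ?thesis by simp
      qed
      moreover have "u (r *\<^sub>R x) \<le> r * u x" if r: "0 \<le> r" for r x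
      proof -
        have *: "u (r *\<^sub>R x) \<le> r * q x" if "q \<in> C" for q
        proof -
          have "sublinear q" using that CA by (auto simp: A_def)
          then show ?thesis
            using u_le[OF that, of "r *\<^sub>R x"] sublinear_scaleR_le[of q r x] r by linarith
        qed
        show ?thesis
        proof (cases "r = 0")
          case True
          then show ?thesis using * False by auto
        next
          case False
          then have "u (r *\<^sub>R x) / r \<le> u x" using * r by (intro u_ge) (simp add: field_simps)
          then show ?thesis using False r by (simp add: field_simps)
        qed
      qed
      moreover have "u \<le> p"
      proof -
        obtain q where q: "q \<in> C" using False by auto
        then have "q \<le> p" using CA by (auto simp: A_def)
        moreover have "u \<le> q" using u_le[OF q] by (simp add: le_fun_def)
        ultimately show ?thesis by (rule order_trans[rotated])
      qed
      ultimately have "u \<in> A" by (simp add: A_def sublinear_def)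
      then show ?thesis using u_le by (auto simp: le_fun_def)
    qed
  qed
  then obtain m where "m \<in> A" "\<And>a. a \<in> A \<Longrightarrow> a \<le> m \<Longrightarrow> a = m" by blast
  then show ?thesis using that[of m] by (auto simp: A_def)
qed

text \<open>A minimal sublinear functional coincides with each of its tilts, and this forces it to
  be linear.\<close>

theorem Hahn_Banach_sublinear:
  fixes p :: "'v::real_vector \<Rightarrow> real"
  assumes p: "sublinear p"
  obtains \<psi> where "linear \<psi>" "\<And>x. \<psi> x \<le> p x" "\<psi> x0 = p x0"
proof -
  \<comment> \<open>Minimising below \<open>tilt p x0\<close> instead of \<open>p\<close> pins the
    value at \<open>x0\<close>.\<close>
  obtain q where q: "sublinear q" "q \<le> tilt p x0"
      and min: "\<And>r. sublinear r \<Longrightarrow> r \<le> q \<Longrightarrow> r = q"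
    using ex_minimal_sublinear[OF sublinear_tilt[OF p, of x0]] by metis
  have add: "q (x + y) = q x + q y" for x y
  proof (rule order_antisym)
    show "q (x + y) \<le> q x + q y" by (rule sublinear_add[OF q(1)])
    \<comment> \<open>The index 1 in the infimum then reads
      \<open>q x \<le> q (x + y) - q y\<close>.\<close>
    have "tilt q y = q"
      by (rule min[OF sublinear_tilt[OF q(1)]]) (simp add: le_fun_def tilt_le_self[OF q(1)])
    then show "q x + q y \<le> q (x + y)" using tilt_le[OF q(1), of 1 y x] by simp
  qed
  have neg: "q (- x) = - q x" for x
    using add[of x "- x"] sublinear_zero[OF q(1)] by simp
  have "q (r *\<^sub>R x) = r * q x" for r x
  proof (cases "0 \<le> r")
    case True
    then show ?thesis by (rule sublinear_scaleR[OF q(1)])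
  next
    case False
    then show ?thesis using sublinear_scaleR[OF q(1), of "- r" x] neg[of "r *\<^sub>R x"] by simp
  qed
  then have "linear q" using add by (intro linearI) auto
  moreover have le: "q x \<le> p x" for x
    using q(2) tilt_le_self[OF p, of x0 x] by (auto simp: le_fun_def intro: order_trans)
  moreover have "q x0 = p x0"
  proof (rule order_antisym[OF le])
    have "q (- x0) \<le> tilt p x0 (- x0)" using q(2) by (simp add: le_fun_def)
    also have "\<dots> \<le> - p x0" using tilt_le[OF p, of 1 x0 "- x0"] sublinear_zero[OF p] by simp
    finally show "p x0 \<le> q x0" using neg by simp
  qed
  ultimately show ?thesis by (rule that)
qed

section \<open>Analytic continuation of orbits\<close>

text \<open>\<open>Arg\<close> is continuous off the nonpositive real axis, and the sector avoids
  that axis since its nonzero points have argument \<open>pi\<close>.\<close>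

lemma open_sector:
  assumes "\<delta> \<le> pi" shows "open (sector \<delta>)"
proof -
  have eq: "sector \<delta> = - \<real>\<^sub>\<le>\<^sub>0 \<inter> Arg -` {-\<delta><..<\<delta>}"
  proof -
    have "z \<notin> \<real>\<^sub>\<le>\<^sub>0" if "z \<noteq> 0" "\<bar>Arg z\<bar> < \<delta>" for z
    proof
      assume "z \<in> \<real>\<^sub>\<le>\<^sub>0"
      then have "Arg z = pi" using that(1)
        by (auto simp: Arg_eq_pi complex_nonpos_Reals_iff complex_eq_iff)
      then show False using that(2) assms by simp
    qed
    then show ?thesis by (fastforce simp: sector_def abs_less_iff)
  qed
  have "continuous_on (- \<real>\<^sub>\<le>\<^sub>0) Arg" by (simp add: continuous_at_imp_continuous_on continuous_at_Arg)
  then show ?thesis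
    unfolding eq by (rule continuous_open_preimage) auto
qed

text \<open>Polar coordinates exhibit the sector as a continuous image of a product of two
  intervals.\<close>

lemma connected_sector:
  assumes "\<delta> \<le> pi" shows "connected (sector \<delta>)"
proof -
  have "sector \<delta> = (\<lambda>(r, \<theta>). r *\<^sub>R cis \<theta>) ` ({0<..} \<times> {-\<delta><..<\<delta>})"
  proof (intro set_eqI iffI)
    fix z assume "z \<in> sector \<delta>"
    then have "z = cmod z *\<^sub>R cis (Arg z)" "0 < cmod z" "\<bar>Arg z\<bar> < \<delta>"
      by (auto simp: sector_def Arg_eq cis_conv_exp scaleR_conv_of_real)
    then show "z \<in> (\<lambda>(r, \<theta>). r *\<^sub>R cis \<theta>) ` ({0<..} \<times> {-\<delta><..<\<delta>})"
      by (intro image_eqI[of _ _ "(cmod z, Arg z)"]) auto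
  next
    fix z assume "z \<in> (\<lambda>(r, \<theta>). r *\<^sub>R cis \<theta>) ` ({0<..} \<times> {-\<delta><..<\<delta>})"
    then obtain r \<theta> where *: "z = r *\<^sub>R cis \<theta>" "0 < r" "-\<delta> < \<theta>" "\<theta> < \<delta>" by auto
    then have "Arg z = \<theta>" using assms
      by (intro Arg_unique[of r]) (auto simp: cis_conv_exp scaleR_conv_of_real)
    then show "z \<in> sector \<delta>" using * by (auto simp: sector_def)
  qed
  moreover have "continuous_on ({0<..} \<times> {-\<delta><..<\<delta>}) (\<lambda>(r, \<theta>). r *\<^sub>R cis \<theta>)"
    unfolding split_def cis_conv_exp by (intro continuous_intros)
  ultimately show ?thesis
    by (simp add: connected_continuous_image connected_Times is_interval_connected
        del: is_interval_oo)
qed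

text \<open>For positive times this is the identity theorem on the open, connected sector. Time 0
  lies outside the sector and is reached by strong continuity.\<close>

lemma analytic_semigroup_identity:
  fixes T :: "real \<Rightarrow> 'b::complex_banach \<Rightarrow>\<^sub>L 'b"
    and \<phi> :: "'b \<Rightarrow>\<^sub>L complex"
  assumes an: "analytic_semigroup T" and \<phi>: "clinear \<phi>"
    and zero: "\<And>t. t0 \<le> t \<Longrightarrow> blinfun_apply \<phi> (blinfun_apply (T t) f) = 0"
    and t: "0 \<le> t"
  shows "blinfun_apply \<phi> (blinfun_apply (T t) f) = 0"
proof -
  obtain \<delta> S where \<delta>: "0 < \<delta>" "\<delta> \<le> pi / 2"
    and ST: "\<And>t. 0 \<le> t \<Longrightarrow> S (complex_of_real t) = T t"
    and hol: "S vholomorphic_on sector \<delta>" and C0: "C0_semigroup T"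
    using an unfolding analytic_semigroup_def by blast
  have \<delta>pi: "\<delta> \<le> pi" using \<delta>(2) pi_gt_zero by linarith
  define F where "F z = blinfun_apply \<phi> (blinfun_apply (S z) f)" for z
  have "F holomorphic_on sector \<delta>"
    unfolding holomorphic_on_def field_differentiable_def
  proof
    fix z assume "z \<in> sector \<delta>"
    then obtain D where D: "(S has_derivative (\<lambda>h. h *\<^sub>C D)) (at z within sector \<delta>)"
      using hol by (auto simp: vholomorphic_on_def)
    \<comment> \<open>Evaluating at \<open>f\<close> and then applying \<open>\<phi>\<close> is
      bounded and linear, so it carries over the operator-norm derivative of \<open>S\<close>;
      complex linearity of \<open>\<phi>\<close> makes the result a complex derivative.\<close>
    have bl: "bounded_linear (\<lambda>A. blinfun_apply \<phi> (blinfun_apply A f))"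
      by (intro bounded_linear_intros)
    have "((\<lambda>z. blinfun_apply \<phi> (blinfun_apply (S z) f)) has_derivative
        (\<lambda>h. blinfun_apply \<phi> (blinfun_apply (h *\<^sub>C D) f))) (at z within sector \<delta>)"
      by (rule bounded_linear.has_derivative[OF bl D])
    moreover have "(\<lambda>h. blinfun_apply \<phi> (blinfun_apply (h *\<^sub>C D) f))
        = (*) (blinfun_apply \<phi> (blinfun_apply D f))"
      using \<phi> by (auto simp: scaleC_blinfun.rep_eq clinear_def scaleC_complex_def)
    ultimately have "(F has_field_derivative blinfun_apply \<phi> (blinfun_apply D f))
        (at z within sector \<delta>)"
      by (simp add: has_field_derivative_def F_def[abs_def])
    then show "\<exists>f'. (F has_field_derivative f') (at z within sector \<delta>)" ..
  qed
  have pos: "complex_of_real s \<in> sector \<delta>" if "0 < s" for s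
    using that \<delta> by (simp add: sector_def)
  have zeroF: "F (complex_of_real s) = 0" if s: "0 < s" for s
  proof -
    \<comment> \<open>The maximum with 1 puts the accumulation point of zeros inside the sector even
      when \<open>t0 \<le> 0\<close>.\<close>
    define a where "a = max 1 t0"
    have a: "0 < a" "t0 \<le> a" by (auto simp: a_def)
    let ?U = "complex_of_real ` {a..}"
    have "a islimpt {a..}"
    proof -
      have "a islimpt {a..<a+1}" by simp
      then show ?thesis by (rule islimpt_subset) auto
    qed
    then have lim: "complex_of_real a islimpt ?U"
      by (intro islimpt_isCont_image) (auto simp: eventually_at_filter)
    show ?thesis
    proof (rule analytic_continuation[OF \<open>F holomorphic_on sector \<delta>\<close> open_sector[OF \<delta>pi]
            connected_sector[OF \<delta>pi] _ pos[OF a(1)] lim _ pos[OF s]])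
      show "?U \<subseteq> sector \<delta>" using pos a by force
      show "F z = 0" if "z \<in> ?U" for z using that a zero by (auto simp: F_def ST)
    qed
  qed
  show ?thesis
  proof (cases "t = 0")
    case False
    then show ?thesis using zeroF[of t] ST[of t] t by (simp add: F_def)
  next
    case True
    have "((\<lambda>t. blinfun_apply (T t) f) \<longlongrightarrow> f) (at_right 0)"
      using C0 by (simp add: C0_semigroup_def)
    then have "((\<lambda>t. blinfun_apply \<phi> (blinfun_apply (T t) f)) \<longlongrightarrow> blinfun_apply \<phi> f) (at_right 0)"
      by (intro tendsto_intros)
    moreover have "\<forall>\<^sub>F t in at_right 0. blinfun_apply \<phi> (blinfun_apply (T t) f) = 0"
      using zeroF ST by (auto simp: F_def eventually_at_filter intro!: always_eventually)
    ultimately have "((\<lambda>t. 0) \<longlongrightarrow> blinfun_apply \<phi> f) (at_right (0::real))"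
      using tendsto_cong by fast
    then have "blinfun_apply \<phi> f = 0"
      by (metis tendsto_unique tendsto_const trivial_limit_at_right_real)
    then show ?thesis using C0 True by (simp add: C0_semigroup_def)
  qed
qed

section \<open>Separation from closed subspaces\<close>

text \<open>Hahn-Banach is applied to the functional that \<open>N\<close> induces on the quotient
  by \<open>I\<close>. Symmetry of \<open>N\<close> is not assumed, so that besides the norm also
  the norm of the positive part can be inserted, which produces positive functionals.\<close>

lemma Hahn_Banach_quotient:
  fixes N :: "'v::real_vector \<Rightarrow> real"
  assumes N: "sublinear N" "\<And>x. 0 \<le> N x" and I: "subspace I"
    and e: "0 < e" "\<And>h. h \<in> I \<Longrightarrow> e \<le> N (x0 - h)"
  obtains \<psi> where "linear \<psi>" "\<And>x. \<psi> x \<le> N x" "\<And>h. h \<in> I \<Longrightarrow> \<psi> h = 0" "0 < \<psi> x0"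
proof -
  define p where "p x = (INF h\<in>I. N (x - h))" for x
  have p_le: "p x \<le> N (x - h)" if "h \<in> I" for x h
    unfolding p_def using N(2) that by (intro cINF_lower bdd_belowI2[of _ 0])
  have p_ge: "m \<le> p x" if "\<And>h. h \<in> I \<Longrightarrow> m \<le> N (x - h)" for m x
    unfolding p_def using subspace_0[OF I] that by (intro cINF_greatest) auto
  have "p (x + y) \<le> p x + p y" for x y
  proof -
    have "p (x + y) - N (y - k) \<le> p x" if k: "k \<in> I" for k
    proof (rule p_ge)
      fix h assume h: "h \<in> I"
      have "p (x + y) \<le> N (x + y - (h + k))" by (rule p_le) (rule subspace_add[OF I h k])
      also have "x + y - (h + k) = (x - h) + (y - k)" by simp
      also have "N \<dots> \<le> N (x - h) + N (y - k)" by (rule sublinear_add[OF N(1)])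
      finally show "p (x + y) - N (y - k) \<le> N (x - h)" by simp
    qed
    then have "p (x + y) - p x \<le> p y" by (intro p_ge) (simp add: algebra_simps)
    then show ?thesis by simp
  qed
  moreover have "p (r *\<^sub>R x) \<le> r * p x" if r: "0 \<le> r" for r x
  proof (cases "r = 0")
    case True
    then show ?thesis using p_le[OF subspace_0[OF I], of 0] sublinear_zero[OF N(1)] by simp
  next
    case False
    have "p (r *\<^sub>R x) / r \<le> p x"
    proof (rule p_ge)
      fix h assume h: "h \<in> I"
      have "p (r *\<^sub>R x) \<le> N (r *\<^sub>R (x - h))"
        using p_le[OF subspace_scale[OF I h], of "r *\<^sub>R x" r] by (simp add: scaleR_right_diff_distrib)
      also have "\<dots> \<le> r * N (x - h)" by (rule sublinear_scaleR_le[OF N(1) r])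
      finally show "p (r *\<^sub>R x) / r \<le> N (x - h)" using False r by (simp add: field_simps)
    qed
    then show ?thesis using False r by (simp add: field_simps)
  qed
  ultimately have "sublinear p" by (simp add: sublinear_def)
  then obtain \<psi> where \<psi>: "linear \<psi>" "\<And>x. \<psi> x \<le> p x" "\<psi> x0 = p x0"
    using Hahn_Banach_sublinear[of p x0] by blast
  show ?thesis
  proof (rule that[OF \<psi>(1)])
    show "\<psi> x \<le> N x" for x
      using \<psi>(2)[of x] p_le[OF subspace_0[OF I], of x] by simp
    \<comment> \<open>Since \<open>p h \<le> 0\<close> on \<open>I\<close>, the bound for
      \<open>h\<close> and for \<open>- h\<close> together gives 0.\<close>
    have le0: "\<psi> h \<le> 0" if "h \<in> I" for h
      using \<psi>(2)[of h] p_le[OF that, of h] sublinear_zero[OF N(1)] by simp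
    show "\<psi> h = 0" if "h \<in> I" for h
      using le0[OF that] le0[OF subspace_neg[OF I that]] linear_neg[OF \<psi>(1), of h] by simp
    show "0 < \<psi> x0" using p_ge[OF e(2)] e(1) \<psi>(3) by simp
  qed
qed

lemma scaleC_Re_Im:
  fixes x :: "'b::complex_normed_space"
  shows "c *\<^sub>C x = Re c *\<^sub>R x + Im c *\<^sub>R (\<i> *\<^sub>C x)"
proof -
  have "c *\<^sub>C x = (complex_of_real (Re c) + complex_of_real (Im c) * \<i>) *\<^sub>C x"
    using arg_cong[where f = "\<lambda>d. d *\<^sub>C x", OF complex_eq[of c]] by (simp only: mult.commute)
  then show ?thesis by (simp only: scaleC_add_left scaleC_of_real flip: scaleC_scaleC)
qed

lemma closed_dist_ge:
  assumes "closed S" "x \<notin> S"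
  obtains e where "0 < e" "\<And>y. y \<in> S \<Longrightarrow> e \<le> dist x y"
proof -
  obtain e where "0 < e" "ball x e \<subseteq> - S"
    using open_Compl[OF assms(1)] assms(2) by (auto simp: open_contains_ball)
  then show ?thesis using that[of e] by (force simp: subset_iff not_less)
qed

text \<open>A real functional that vanishes on \<open>I\<close> and is positive at \<open>x\<close>
  is complexified; stability of \<open>I\<close> under multiplication by \<open>\<i>\<close> makes
  the imaginary part vanish on \<open>I\<close> too.\<close>

lemma ex_clinear_separating:
  fixes I :: "'b::complex_normed_space set"
  assumes "closed I" and I: "subspace I" and iI: "\<And>c x. x \<in> I \<Longrightarrow> c *\<^sub>C x \<in> I" and x: "x \<notin> I"
  obtains \<phi> :: "'b \<Rightarrow>\<^sub>L complex"
    where "clinear \<phi>" "\<And>y. y \<in> I \<Longrightarrow> blinfun_apply \<phi> y = 0" "blinfun_apply \<phi> x \<noteq> 0"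
proof -
  obtain e where e: "0 < e" "\<And>h. h \<in> I \<Longrightarrow> e \<le> norm (x - h)"
    using closed_dist_ge[OF \<open>closed I\<close> x, unfolded dist_norm] by blast
  have N: "sublinear (norm :: 'b \<Rightarrow> real)" by (simp add: sublinear_def norm_triangle_ineq)
  obtain \<psi> where \<psi>: "linear \<psi>" "\<And>y. \<psi> y \<le> norm y" "\<And>h. h \<in> I \<Longrightarrow> \<psi> h = 0" "0 < \<psi> x"
    using Hahn_Banach_quotient[OF N norm_ge_zero I e] by blast
  interpret linear \<psi> by (rule \<psi>(1))
  have abs_\<psi>: "\<bar>\<psi> y\<bar> \<le> norm y" for y
    using \<psi>(2)[of y] \<psi>(2)[of "- y"] neg[of y] by (simp add: abs_le_iff)
  \<comment> \<open>The complex-linear functional whose real part is \<open>\<psi>\<close>.\<close>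
  define f where "f y = Complex (\<psi> y) (- \<psi> (\<i> *\<^sub>C y))" for y
  have fC: "f (c *\<^sub>C y) = c * f y" for c y
  proof -
    have *: "\<psi> (c *\<^sub>C y) = Re c * \<psi> y + Im c * \<psi> (\<i> *\<^sub>C y)" for c
      by (subst scaleC_Re_Im) (simp add: add scale)
    show ?thesis
      using *[of c] *[of "\<i> * c"] by (simp add: f_def complex_eq_iff scaleC_scaleC)
  qed
  have "bounded_linear f"
  proof (rule bounded_linear_intro[where K = 2])
    show "f (y + z) = f y + f z" for y z by (simp add: f_def complex_eq_iff scaleC_add_right add)
    show "f (r *\<^sub>R y) = r *\<^sub>R f y" for r y
      using fC[of "complex_of_real r" y] by (simp add: scaleC_of_real scaleR_conv_of_real)
    show "norm (f y) \<le> norm y * 2" for y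
      using cmod_le[of "f y"] abs_\<psi>[of y] abs_\<psi>[of "\<i> *\<^sub>C y"] by (simp add: f_def norm_scaleC)
  qed
  then have f: "blinfun_apply (Blinfun f) = f" by (rule bounded_linear_Blinfun_apply)
  show ?thesis
  proof (rule that[of "Blinfun f"])
    show "clinear (Blinfun f)" by (simp add: clinear_def f fC scaleC_complex_def)
    show "blinfun_apply (Blinfun f) y = 0" if "y \<in> I" for y
      using \<psi>(3) iI that by (simp add: f f_def complex_eq_iff)
    show "blinfun_apply (Blinfun f) x \<noteq> 0" using \<psi>(4) by (simp add: f f_def complex_eq_iff)
  qed
qed

section \<open>Closed ideals\<close>

lemma closed_ideal_closed: "closed_ideal I \<Longrightarrow> closed I"
  and closed_ideal_scaleC: "closed_ideal I \<Longrightarrow> f \<in> I \<Longrightarrow> c *\<^sub>C f \<in> I"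
  by (simp_all add: closed_ideal_def)

lemma closed_ideal_solid: "closed_ideal I \<Longrightarrow> g \<in> I \<Longrightarrow> modulus f \<le> modulus g \<Longrightarrow> f \<in> I"
  by (auto simp: closed_ideal_def abs_complexification_def less_eq_complexification_def)

lemma closed_ideal_subspace:
  assumes "closed_ideal I" shows "subspace I"
  unfolding subspace_def
proof (intro conjI ballI allI)
  show "r *\<^sub>R f \<in> I" if "f \<in> I" for r f
    using closed_ideal_scaleC[OF assms that, of "complex_of_real r"] by (simp add: scaleC_of_real)
qed (use assms in \<open>auto simp: closed_ideal_def\<close>)

lemma modulus_Cplx: "modulus (Cplx x 0) = \<bar>x\<bar>"
  using abs_cre_le_modulus[of "Cplx x 0"] modulus_le[of "Cplx x 0"] by (simp add: order_antisym)

lemma complexification_eq_cre_cim: "z = Cplx (cre z) 0 + \<i> *\<^sub>C Cplx (cim z) 0"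
  by (simp add: complexification_eq_iff)

lemma bounded_linear_Cplx: "bounded_linear (\<lambda>x::'a::banach_lattice. Cplx x 0)"
proof (rule bounded_linear_intro[where K = 1])
  show "norm (Cplx x 0) \<le> norm x * 1" for x :: 'a
    using norm_complexification_le[of "Cplx x 0"] by simp
qed (simp_all add: complexification_eq_iff)

text \<open>Domination by this functional forces positivity: if \<open>0 \<le> x\<close>, then
  \<open>pprt (- x) = 0\<close>, so a dominated linear functional is at most 0 at
  \<open>- x\<close>.\<close>

lemma sublinear_norm_pprt: "sublinear (\<lambda>x::'a::banach_lattice. norm (pprt x))"
  unfolding sublinear_def
proof (intro conjI allI impI)
  fix x y :: 'a and r :: real
  have "pprt (x + y) \<le> pprt x + pprt y"
    unfolding pprt_def by (intro le_supI add_mono add_nonneg_nonneg) auto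
  then show "norm (pprt (x + y)) \<le> norm (pprt x) + norm (pprt y)"
    by (meson bl_norm_mono norm_triangle_ineq order_trans zero_le_pprt)
  assume r: "0 \<le> r"
  have "pprt (r *\<^sub>R x) \<le> r *\<^sub>R pprt x"
    unfolding pprt_def using r by (intro le_supI scaleR_left_mono scaleR_nonneg_nonneg) auto
  then have "norm (pprt (r *\<^sub>R x)) \<le> norm (r *\<^sub>R pprt x)" by (rule bl_norm_mono[OF zero_le_pprt])
  then show "norm (pprt (r *\<^sub>R x)) \<le> r * norm (pprt x)" using r by simp
qed

text \<open>The real elements of \<open>I\<close> form a closed ideal \<open>J\<close> of the real
  lattice. Separating some \<open>\<bar>g\<bar>\<close> from \<open>J\<close> with respect to the
  norm of the positive part gives a positive real functional, which is extended
  complex-linearly.\<close>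

lemma ex_dual_nonneg_vanishing:
  fixes I :: "'a::banach_lattice complexification set"
  assumes I: "closed_ideal I" and "I \<noteq> UNIV"
  obtains \<phi> where "dual_nonneg \<phi>" "\<phi> \<noteq> 0" "\<And>f. f \<in> I \<Longrightarrow> blinfun_apply \<phi> f = 0"
proof -
  note sub = closed_ideal_subspace[OF I]
  define J where "J = {x. Cplx x 0 \<in> I}"
  interpret C: bounded_linear "\<lambda>x::'a. Cplx x 0" by (rule bounded_linear_Cplx)
  have J: "subspace J"
    unfolding J_def using sub
    by (auto simp: subspace_def C.add C.scaleR C.zero)
  have J_solid: "x \<in> J" if "y \<in> J" "\<bar>x\<bar> \<le> \<bar>y\<bar>" for x y
    using closed_ideal_solid[OF I, of "Cplx y 0"] that by (simp add: J_def modulus_Cplx)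
  have "closed J"
    unfolding J_def using continuous_closed_vimage[OF closed_ideal_closed[OF I] C.isCont[OF continuous_ident]]
    by (simp add: vimage_def)
  have cre_cim: "cre z \<in> J" "cim z \<in> J" if "z \<in> I" for z
    using closed_ideal_solid[OF I that] abs_cre_le_modulus[of z] abs_cim_le_modulus[of z]
    by (simp_all add: J_def modulus_Cplx)
  obtain z where "z \<notin> I" using \<open>I \<noteq> UNIV\<close> by auto
  then have "\<not> (cre z \<in> J \<and> cim z \<in> J)"
    using complexification_eq_cre_cim[of z] subspace_add[OF sub] closed_ideal_scaleC[OF I]
    unfolding J_def by (metis mem_Collect_eq)
  \<comment> \<open>A part of \<open>z\<close> outside \<open>J\<close> serves as \<open>g\<close>;
    by solidity its modulus is outside \<open>J\<close> as well.\<close>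
  then obtain g where "\<bar>g\<bar> \<notin> J" using J_solid[of "\<bar>_\<bar>"] by auto
  obtain e where e: "0 < e" "\<And>h. h \<in> J \<Longrightarrow> e \<le> norm (\<bar>g\<bar> - h)"
    using closed_dist_ge[OF \<open>closed J\<close> \<open>\<bar>g\<bar> \<notin> J\<close>, unfolded dist_norm] by blast
  have e': "e \<le> norm (pprt (\<bar>g\<bar> - h))" if h: "h \<in> J" for h
  proof -
    \<comment> \<open>Solidity puts \<open>k\<close> into \<open>J\<close>, and
      \<open>\<bar>g\<bar> - k \<le> pprt (\<bar>g\<bar> - h)\<close>. Thus the norm distance from
      \<open>\<bar>g\<bar>\<close> to \<open>J\<close> bounds the asymmetric distance from
      below.\<close>
    define k where "k = inf \<bar>g\<bar> \<bar>h\<bar>"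
    have k: "0 \<le> k" "k \<le> \<bar>g\<bar>" "k \<le> \<bar>h\<bar>" by (simp_all add: k_def)
    then have "k \<in> J" by (intro J_solid[OF h]) simp
    have "\<bar>g\<bar> - pprt (\<bar>g\<bar> - h) \<le> k"
      unfolding k_def
    proof (rule inf.boundedI)
      have "\<bar>g\<bar> - pprt (\<bar>g\<bar> - h) \<le> \<bar>g\<bar> - (\<bar>g\<bar> - h)"
        by (intro diff_left_mono) (simp add: pprt_def)
      also have "\<dots> \<le> \<bar>h\<bar>" by (simp add: abs_ge_self)
      finally show "\<bar>g\<bar> - pprt (\<bar>g\<bar> - h) \<le> \<bar>h\<bar>" .
    qed simp
    then have "\<bar>g\<bar> - k \<le> pprt (\<bar>g\<bar> - h)" by (simp add: diff_le_eq add.commute)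
    then have "norm (\<bar>g\<bar> - k) \<le> norm (pprt (\<bar>g\<bar> - h))"
      using k by (intro bl_norm_mono) simp_all
    then show ?thesis using e(2)[OF \<open>k \<in> J\<close>] by simp
  qed
  obtain \<psi> where \<psi>: "linear \<psi>" "\<And>x. \<psi> x \<le> norm (pprt x)" "\<And>h. h \<in> J \<Longrightarrow> \<psi> h = 0"
      "0 < \<psi> \<bar>g\<bar>"
    using Hahn_Banach_quotient[OF sublinear_norm_pprt norm_ge_zero J e(1) e'] by blast
  interpret linear \<psi> by (rule \<psi>(1))
  have \<psi>_nonneg: "0 \<le> \<psi> x" if "0 \<le> x" for x
    using \<psi>(2)[of "- x"] that neg[of x] by simp
  have \<psi>_le: "\<psi> x \<le> norm x" for x
  proof -
    have "pprt x \<le> \<bar>x\<bar>" by (simp add: pprt_def abs_ge_self)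
    then have "norm (pprt x) \<le> norm \<bar>x\<bar>" by (intro bl_norm_mono) simp_all
    then show ?thesis using \<psi>(2)[of x] by (simp add: bl_norm_abs)
  qed
  have abs_\<psi>: "\<bar>\<psi> x\<bar> \<le> norm x" for x
    using \<psi>_le[of x] \<psi>_le[of "- x"] neg[of x] by (simp add: abs_le_iff)
  \<comment> \<open>The canonical complex-linear extension; on positive vectors the imaginary part
    is 0, so positivity of \<open>\<psi>\<close> carries over.\<close>
  define F where "F z = Complex (\<psi> (cre z)) (\<psi> (cim z))" for z
  have "bounded_linear F"
  proof (rule bounded_linear_intro[where K = 2])
    show "norm (F z) \<le> norm z * 2" for z
      using cmod_le[of "F z"] abs_\<psi>[of "cre z"] abs_\<psi>[of "cim z"] norm_cre_le[of z] norm_cim_le[of z]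
      by (simp add: F_def)
  qed (simp_all add: F_def complex_eq_iff add scale)
  then have F: "blinfun_apply (Blinfun F) = F" by (rule bounded_linear_Blinfun_apply)
  show ?thesis
  proof (rule that[of "Blinfun F"])
    show "dual_nonneg (Blinfun F)"
      by (auto simp: dual_nonneg_def clinear_def F F_def complex_eq_iff scaleC_complex_def
          less_eq_complexification_def add diff scale zero \<psi>_nonneg complex_nonneg_Reals_iff)
    have "blinfun_apply (Blinfun F) (Cplx \<bar>g\<bar> 0) \<noteq> 0"
      using \<psi>(4) by (simp add: F F_def complex_eq_iff)
    then show "Blinfun F \<noteq> 0" by auto
    show "blinfun_apply (Blinfun F) f = 0" if "f \<in> I" for f
      using cre_cim[OF that] \<psi>(3) by (simp add: F F_def complex_eq_iff)
  qed
qed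

section \<open>The modulus as a map on the complex lattice, and decomposition into positive
  vectors\<close>

lemma abs_complexification_of_nonneg: "0 \<le> f \<Longrightarrow> \<bar>f\<bar> = f" for f :: "'a::banach_lattice complexification"
  by (cases f) (auto simp: less_eq_complexification_def abs_complexification_def modulus_Cplx)

lemma abs_complexification_nonneg: "0 \<le> \<bar>f\<bar>" for f :: "'a::banach_lattice complexification"
  by (simp add: less_eq_complexification_def abs_complexification_def modulus_nonneg)

lemma modulus_diff: "\<bar>modulus f - modulus g\<bar> \<le> modulus (f - g)"
proof (rule abs_leI)
  have le: "modulus f - modulus g \<le> modulus (f - g)" for f g :: "'a complexification"
    using modulus_add[of "f - g" g] by (simp add: diff_le_eq)
  show "modulus f - modulus g \<le> modulus (f - g)" by (rule le)
  have "modulus (g - f) \<le> modulus (f - g)"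
    using modulus_scaleC_le[of "- 1" "f - g"] scaleC_of_real[of "- 1" "f - g"] by simp
  then show "- (modulus f - modulus g) \<le> modulus (f - g)"
    using order_trans[OF le[of g f]] by simp
qed

text \<open>By the reverse triangle inequality the modulus is Lipschitz with constant 1.\<close>

lemma continuous_on_abs_complexification:
  "continuous_on S (abs :: 'a::banach_lattice complexification \<Rightarrow> _)"
proof (rule lipschitz_on_continuous_on[of 1], rule lipschitz_onI)
  fix f g :: "'a complexification"
  have "\<bar>f\<bar> - \<bar>g\<bar> = Cplx (modulus f - modulus g) 0"
    by (simp add: abs_complexification_def complexification_eq_iff)
  then have "norm (\<bar>f\<bar> - \<bar>g\<bar>) \<le> norm (modulus f - modulus g)"
    using norm_complexification_le[of "\<bar>f\<bar> - \<bar>g\<bar>"] by simp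
  also have "\<dots> \<le> norm (f - g)"
    unfolding norm_complexification_def
    by (rule norm_abs_mono) (simp add: modulus_diff modulus_nonneg)
  finally show "dist \<bar>f\<bar> \<bar>g\<bar> \<le> 1 * dist f g" by (simp add: dist_norm)
qed simp

text \<open>The positive and negative parts of the real and imaginary parts of \<open>f\<close> span
  \<open>f\<close> over the complex numbers. Their moduli are at most that of \<open>f\<close>, so
  they stay in every ideal containing \<open>f\<close>.\<close>

lemma mem_complex_subspace_of_nonneg_parts:
  fixes f :: "'a::banach_lattice complexification"
  assumes V: "subspace V" "\<And>c g. g \<in> V \<Longrightarrow> c *\<^sub>C g \<in> V"
    and parts: "\<And>g. 0 \<le> g \<Longrightarrow> modulus g \<le> modulus f \<Longrightarrow> g \<in> V"
  shows "f \<in> V"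
proof -
  have part: "Cplx x 0 \<in> V" if x: "\<bar>x\<bar> \<le> modulus f" for x
  proof -
    have "pprt x \<le> \<bar>x\<bar>" "- nprt x \<le> \<bar>x\<bar>" by (simp_all add: abs_prts)
    then have "Cplx (pprt x) 0 \<in> V" "Cplx (- nprt x) 0 \<in> V"
      using order_trans[OF _ x]
      by (auto intro!: parts simp: less_eq_complexification_def modulus_Cplx)
    moreover have "Cplx x 0 = Cplx (pprt x) 0 - Cplx (- nprt x) 0"
      by (simp add: complexification_eq_iff flip: prts)
    ultimately show ?thesis using subspace_diff[OF V(1)] by metis
  qed
  show ?thesis
    by (subst complexification_eq_cre_cim)
      (intro subspace_add[OF V(1)] V(2) part abs_cre_le_modulus abs_cim_le_modulus)
qed

section \<open>Eventually positive analytic semigroups\<close>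

text \<open>A functional separating \<open>T t f\<close> from \<open>I\<close> would vanish on the
  orbit past \<open>t0\<close>, hence on the whole orbit.\<close>

lemma analytic_semigroup_mem_closed_subspace:
  fixes T :: "real \<Rightarrow> 'b::complex_banach \<Rightarrow>\<^sub>L 'b"
  assumes "analytic_semigroup T" "closed I" "subspace I" "\<And>c x. x \<in> I \<Longrightarrow> c *\<^sub>C x \<in> I"
    and "\<And>t. t0 \<le> t \<Longrightarrow> blinfun_apply (T t) f \<in> I" and "0 \<le> t"
  shows "blinfun_apply (T t) f \<in> I"
proof (rule ccontr)
  assume "blinfun_apply (T t) f \<notin> I"
  then obtain \<phi> :: "'b \<Rightarrow>\<^sub>L complex"
    where \<phi>: "clinear \<phi>" "\<And>y. y \<in> I \<Longrightarrow> blinfun_apply \<phi> y = 0"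
      and "blinfun_apply \<phi> (blinfun_apply (T t) f) \<noteq> 0"
    using ex_clinear_separating[OF assms(2-4)] by blast
  moreover have "blinfun_apply \<phi> (blinfun_apply (T t) f) = 0"
    by (rule analytic_semigroup_identity[OF assms(1) \<phi>(1) _ assms(6), where ?t0.0 = t0])
      (rule \<phi>(2)[OF assms(5)])
  ultimately show False by simp
qed

section \<open>The implications between the five conditions\<close>

lemma persistently_irreducible_iff:
  assumes "analytic_semigroup T"
  shows "persistently_irreducible_semigroup T \<longleftrightarrow> irreducible_semigroup T"
proof -
  \<comment> \<open>Both notions of irreducibility thus quantify over the same ideals.\<close>
  have "closed_ideal I \<and> (\<exists>t0\<ge>0. \<forall>t\<ge>t0. blinfun_apply (T t) ` I \<subseteq> I) \<longleftrightarrow>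
      closed_ideal I \<and> (\<forall>t\<ge>0. blinfun_apply (T t) ` I \<subseteq> I)" for I
  proof (intro conj_cong refl)
    assume I: "closed_ideal I"
    have "blinfun_apply (T t) f \<in> I"
      if "0 \<le> t" "f \<in> I" "\<forall>t\<ge>t0. blinfun_apply (T t) ` I \<subseteq> I" for t t0 f
      by (rule analytic_semigroup_mem_closed_subspace[OF assms closed_ideal_closed[OF I]
            closed_ideal_subspace[OF I] closed_ideal_scaleC[OF I],
            where ?t0.0 = t0])
        (use that in auto)
    then show "(\<exists>t0\<ge>0. \<forall>t\<ge>t0. blinfun_apply (T t) ` I \<subseteq> I) \<longleftrightarrow>
        (\<forall>t\<ge>0. blinfun_apply (T t) ` I \<subseteq> I)"
      by blast
  qed
  then show ?thesis
    unfolding persistently_irreducible_semigroup_def irreducible_semigroup_def by simp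
qed

text \<open>A nontrivial invariant closed ideal contains some \<open>\<bar>g\<bar> > 0\<close> with
  its orbit and is annihilated by a nonzero positive functional, contrary to the assumption.\<close>

lemma nonvanishing_imp_irreducible:
  assumes nv: "\<And>f \<phi>. 0 < f \<Longrightarrow> dual_nonneg \<phi> \<Longrightarrow> \<phi> \<noteq> 0 \<Longrightarrow>
      \<exists>t\<ge>0. blinfun_apply \<phi> (blinfun_apply (T t) f) \<noteq> 0"
  shows "irreducible_semigroup T"
  unfolding irreducible_semigroup_def
proof (intro allI impI)
  fix I assume "closed_ideal I \<and> (\<forall>t\<ge>0. blinfun_apply (T t) ` I \<subseteq> I)"
  then have I: "closed_ideal I" and inv: "\<And>t f. 0 \<le> t \<Longrightarrow> f \<in> I \<Longrightarrow> blinfun_apply (T t) f \<in> I"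
    by auto
  show "I = {0} \<or> I = UNIV"
  proof (rule ccontr)
    assume "\<not> (I = {0} \<or> I = UNIV)"
    then have "I \<noteq> {0}" "I \<noteq> UNIV" by auto
    obtain \<phi> where \<phi>: "dual_nonneg \<phi>" "\<phi> \<noteq> 0" "\<And>f. f \<in> I \<Longrightarrow> blinfun_apply \<phi> f = 0"
      by (rule ex_dual_nonneg_vanishing[OF I \<open>I \<noteq> UNIV\<close>]) blast
    obtain g where g: "g \<in> I" "g \<noteq> 0"
      using \<open>I \<noteq> {0}\<close> subspace_0[OF closed_ideal_subspace[OF I]] by auto
    have "\<bar>g\<bar> \<in> I"
      by (rule closed_ideal_solid[OF I g(1)])
        (simp add: abs_complexification_def modulus_Cplx modulus_nonneg)
    moreover have "norm g \<noteq> 0" using g(2) by simp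
    then have "0 < \<bar>g\<bar>"
      using abs_complexification_nonneg[of g]
      by (auto simp: less_complexification_def abs_complexification_def norm_complexification_def
          complexification_eq_iff)
    ultimately obtain t where "0 \<le> t" "blinfun_apply \<phi> (blinfun_apply (T t) \<bar>g\<bar>) \<noteq> 0"
      using nv[of "\<bar>g\<bar>" \<phi>] \<phi>(1,2) by blast
    then show False using \<phi>(3) inv \<open>\<bar>g\<bar> \<in> I\<close> by simp
  qed
qed

text \<open>If all pairings vanished, \<open>f\<close> would lie in an invariant closed ideal;
  irreducibility makes this ideal the whole space, which forces \<open>\<phi> = 0\<close>.\<close>

lemma irreducible_imp_nonvanishing:
  assumes an: "analytic_semigroup T" and pos: "individually_eventually_positive T"
    and irr: "irreducible_semigroup T"
    and f: "0 < f" and \<phi>: "dual_nonneg \<phi>" "\<phi> \<noteq> 0"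
  shows "\<exists>t\<ge>0. blinfun_apply \<phi> (blinfun_apply (T t) f) \<noteq> 0"
proof (rule ccontr)
  assume "\<not> ?thesis"
  then have van: "blinfun_apply \<phi> (blinfun_apply (T t) f) = 0" if "0 \<le> t" for t
    using that by blast
  have lin_\<phi>: "clinear \<phi>" using \<phi> by (simp add: dual_nonneg_def)
  have T: "\<And>t. 0 \<le> t \<Longrightarrow> clinear (T t)" "T 0 = id_blinfun"
      "\<And>s t. 0 \<le> s \<Longrightarrow> 0 \<le> t \<Longrightarrow> T (s + t) = T s o\<^sub>L T t"
    using an by (auto simp: analytic_semigroup_def C0_semigroup_def)
  \<comment> \<open>Past \<open>max t1 t2\<close> the orbits of \<open>g\<close> and
    \<open>h - g\<close> are positive while \<open>\<phi>\<close> kills that of \<open>h\<close>, so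
    the pairing with the orbit of \<open>g\<close> and its negative are both nonnegative.
    Analyticity extends the vanishing to all times.\<close>
  have dom: "blinfun_apply \<phi> (blinfun_apply (T t) g) = 0"
    if gh: "0 \<le> g" "g \<le> h" and h: "\<And>t. 0 \<le> t \<Longrightarrow> blinfun_apply \<phi> (blinfun_apply (T t) h) = 0"
      and t: "0 \<le> t" for g h t
  proof -
    obtain t1 t2 where t1: "0 \<le> t1" "\<And>t. t1 \<le> t \<Longrightarrow> 0 \<le> blinfun_apply (T t) g"
      and t2: "0 \<le> t2" "\<And>t. t2 \<le> t \<Longrightarrow> 0 \<le> blinfun_apply (T t) (h - g)"
      using pos gh unfolding individually_eventually_positive_def by (metis diff_ge_0_iff_ge)
    show ?thesis
    proof (rule analytic_semigroup_identity[OF an lin_\<phi> _ t])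
      fix s assume s: "max t1 t2 \<le> s"
      define c where "c = blinfun_apply \<phi> (blinfun_apply (T s) g)"
      have "c \<in> \<real>\<^sub>\<ge>\<^sub>0" using \<phi>(1) t1 s by (simp add: dual_nonneg_def c_def)
      moreover have "blinfun_apply \<phi> (blinfun_apply (T s) (h - g)) \<in> \<real>\<^sub>\<ge>\<^sub>0"
        using \<phi>(1) t2 s by (simp add: dual_nonneg_def)
      then have "- c \<in> \<real>\<^sub>\<ge>\<^sub>0" using h[of s] t1 s by (simp add: blinfun.diff_right c_def)
      ultimately show "blinfun_apply \<phi> (blinfun_apply (T s) g) = 0"
        by (simp add: complex_nonneg_Reals_iff complex_eq_iff flip: c_def)
    qed
  qed
  \<comment> \<open>Using \<open>\<bar>g\<bar>\<close> reduces solidity and the closure properties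
    to the domination step \<open>dom\<close>.\<close>
  define I where "I = {g. \<forall>t\<ge>0. blinfun_apply \<phi> (blinfun_apply (T t) \<bar>g\<bar>) = 0}"
  have IE: "blinfun_apply \<phi> (blinfun_apply (T t) \<bar>g\<bar>) = 0" if "g \<in> I" "0 \<le> t" for g t
    using that by (simp add: I_def)
  have II: "g \<in> I" if "\<bar>g\<bar> \<le> h" "\<And>t. 0 \<le> t \<Longrightarrow> blinfun_apply \<phi> (blinfun_apply (T t) h) = 0" for g h
    unfolding I_def using dom[OF abs_complexification_nonneg that] by simp
  have I: "closed_ideal I"
    unfolding closed_ideal_def
  proof (intro conjI ballI allI impI)
    have "closed (\<Inter>t\<in>{0..}. {g. blinfun_apply \<phi> (blinfun_apply (T t) \<bar>g\<bar>) = 0})"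
      by (intro closed_INT ballI closed_Collect_eq continuous_intros
          continuous_on_abs_complexification)
    moreover have "I = (\<Inter>t\<in>{0..}. {g. blinfun_apply \<phi> (blinfun_apply (T t) \<bar>g\<bar>) = 0})"
      by (auto simp: I_def)
    ultimately show "closed I" by simp
    show "0 \<in> I" by (rule II[of _ 0]) (simp_all add: abs_complexification_of_nonneg)
    show "g + h \<in> I" if "g \<in> I" "h \<in> I" for g h
    proof (rule II)
      show "\<bar>g + h\<bar> \<le> \<bar>g\<bar> + \<bar>h\<bar>"
        by (simp add: less_eq_complexification_def abs_complexification_def modulus_add)
    qed (simp add: blinfun.add_right IE that)
    show "c *\<^sub>C g \<in> I" if "g \<in> I" for c g
    proof (rule II)
      show "\<bar>c *\<^sub>C g\<bar> \<le> cmod c *\<^sub>R \<bar>g\<bar>"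
        by (simp add: less_eq_complexification_def abs_complexification_def modulus_scaleC_le)
    qed (simp add: blinfun.scaleR_right IE that)
    show "g \<in> I" if "h \<in> I" "\<bar>g\<bar> \<le> \<bar>h\<bar>" for g h
      by (rule II[OF that(2)]) (rule IE[OF that(1)])
  qed
  have inv: "blinfun_apply (T s) g \<in> I" if g: "g \<in> I" and s: "0 \<le> s" for g s
  proof -
    let ?V = "{g. blinfun_apply (T s) g \<in> I}"
    \<comment> \<open>The preimage \<open>?V\<close> of \<open>I\<close> is a complex subspace, so
      only positive vectors dominated by \<open>g\<close> need to be treated; they lie in
      \<open>I\<close> by solidity.\<close>
    have "g \<in> ?V"
    proof (rule mem_complex_subspace_of_nonneg_parts)
      show "subspace ?V"
        using closed_ideal_subspace[OF I]
        by (simp add: subspace_def blinfun.add_right blinfun.scaleR_right blinfun.zero_right)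
      show "c *\<^sub>C h \<in> ?V" if "h \<in> ?V" for c h
        using that T(1)[OF s] closed_ideal_scaleC[OF I] by (simp add: clinear_def)
      fix h assume h: "0 \<le> h" "modulus h \<le> modulus g"
      have hI: "h \<in> I" by (rule closed_ideal_solid[OF I g h(2)])
      obtain t1 where t1: "0 \<le> t1" "\<And>t. t1 \<le> t \<Longrightarrow> 0 \<le> blinfun_apply (T t) h"
        using pos h(1) unfolding individually_eventually_positive_def by metis
      \<comment> \<open>For large \<open>r\<close> the vector \<open>T r h\<close> is positive,
        hence its own modulus, and its pairing at time \<open>t\<close> is that of \<open>h\<close>
        at time \<open>t + r\<close>. Analytic continuation then reaches the given
        \<open>s\<close>.\<close>
      have "blinfun_apply (T s) h \<in> I"
      proof (rule analytic_semigroup_mem_closed_subspace[OF an closed_ideal_closed[OF I]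
            closed_ideal_subspace[OF I] closed_ideal_scaleC[OF I] _ s])
        fix r assume r: "t1 \<le> r"
        show "blinfun_apply (T r) h \<in> I"
        proof (rule II)
          show "\<bar>blinfun_apply (T r) h\<bar> \<le> blinfun_apply (T r) h"
            using t1(2)[OF r] by (simp add: abs_complexification_of_nonneg)
          show "blinfun_apply \<phi> (blinfun_apply (T t) (blinfun_apply (T r) h)) = 0" if "0 \<le> t" for t
            using IE[OF hI, of "t + r"] T(3)[of t r] that r t1(1) h(1)
            by (simp add: abs_complexification_of_nonneg)
        qed
      qed
      then show "h \<in> ?V" by simp
    qed
    then show ?thesis by simp
  qed
  have "f \<in> I"
    using f van
    by (intro II[of f f]) (simp_all add: less_complexification_def abs_complexification_of_nonneg)
  moreover have "f \<noteq> 0" using f by auto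
  ultimately have "I = UNIV"
    using irr I inv unfolding irreducible_semigroup_def by blast
  \<comment> \<open>Time 0 in the definition of \<open>I\<close> shows that \<open>\<phi>\<close>
    kills all positive vectors, and these span the space.\<close>
  have "g \<in> {g. blinfun_apply \<phi> g = 0}" for g
  proof (rule mem_complex_subspace_of_nonneg_parts)
    show "subspace {g. blinfun_apply \<phi> g = 0}"
      by (simp add: subspace_def blinfun.add_right blinfun.scaleR_right blinfun.zero_right)
    show "c *\<^sub>C h \<in> {g. blinfun_apply \<phi> g = 0}" if "h \<in> {g. blinfun_apply \<phi> g = 0}" for c h
      using that lin_\<phi> by (simp add: clinear_def scaleC_complex_def)
    show "h \<in> {g. blinfun_apply \<phi> g = 0}" if "0 \<le> h" for h
      using IE[of h 0] that \<open>I = UNIV\<close> T(2) by (simp add: abs_complexification_of_nonneg)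
  qed
  then have "\<phi> = 0" by (intro blinfun_eqI) simp
  then show False using \<phi>(2) by contradiction
qed

theorem proposition3p11:
  fixes T :: "real \<Rightarrow> ('a::banach_lattice) complexification \<Rightarrow>\<^sub>L 'a complexification"
  assumes "C0_semigroup T"
    and "individually_eventually_positive T"
    and "analytic_semigroup T"
  shows
    "(irreducible_semigroup T \<longleftrightarrow>
       (\<forall>f \<phi>. 0 < f \<and> dual_nonneg \<phi> \<and> \<phi> \<noteq> 0 \<longrightarrow>
          (\<exists>t\<in>{0..}. blinfun_apply \<phi> (blinfun_apply (T t) f) \<noteq> 0))) \<and>
     (irreducible_semigroup T \<longleftrightarrow> persistently_irreducible_semigroup T) \<and>
     (irreducible_semigroup T \<longleftrightarrow>
       (\<forall>f \<phi>. \<forall>t0\<in>{0..}. 0 < f \<and> dual_nonneg \<phi> \<and> \<phi> \<noteq> 0 \<longrightarrow>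
          (\<exists>t\<in>{0} \<union> {t0..}. blinfun_apply \<phi> (blinfun_apply (T t) f) \<noteq> 0))) \<and>
     (irreducible_semigroup T \<longleftrightarrow>
       (\<forall>f \<phi>. \<forall>t0\<in>{0..}. 0 < f \<and> dual_nonneg \<phi> \<and> \<phi> \<noteq> 0 \<longrightarrow>
          (\<exists>t\<in>{t0..}. blinfun_apply \<phi> (blinfun_apply (T t) f) \<noteq> 0)))"
    (is "(_ \<longleftrightarrow> ?ii) \<and> (_ \<longleftrightarrow> _) \<and> (_ \<longleftrightarrow> ?iv) \<and> (_ \<longleftrightarrow> ?v)")
proof -
  \<comment> \<open>Conditions (i), (v), (iv), (ii) are linked in a cycle in this order; (iii) is
    attached to (i).\<close>
  have "irreducible_semigroup T \<Longrightarrow> ?v"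
  proof (intro allI ballI impI)
    fix f :: "'a complexification" and \<phi> :: "'a complexification \<Rightarrow>\<^sub>L complex" and t0 :: real
    assume irr: "irreducible_semigroup T" and *: "0 < f \<and> dual_nonneg \<phi> \<and> \<phi> \<noteq> 0"
    then obtain t where t: "0 \<le> t" "blinfun_apply \<phi> (blinfun_apply (T t) f) \<noteq> 0"
      using irreducible_imp_nonvanishing[OF assms(3,2) irr] by blast
    have "clinear \<phi>" using * by (simp add: dual_nonneg_def)
    \<comment> \<open>If the pairing vanished at all times past \<open>t0\<close>, it would vanish
      at \<open>t\<close> as well.\<close>
    then show "\<exists>t\<in>{t0..}. blinfun_apply \<phi> (blinfun_apply (T t) f) \<noteq> 0"
      using analytic_semigroup_identity[OF assms(3) _ _ t(1)] t(2) by (metis atLeast_iff)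
  qed
  moreover have "?v \<Longrightarrow> ?iv" by blast
  \<comment> \<open>The choice \<open>t0 = 0\<close> turns \<open>{0} \<union> {t0..}\<close> into
    all nonnegative times.\<close>
  moreover have "?iv \<Longrightarrow> ?ii" by fastforce
  moreover have "?ii \<Longrightarrow> irreducible_semigroup T"
    by (rule nonvanishing_imp_irreducible) auto
  moreover have "irreducible_semigroup T \<longleftrightarrow> persistently_irreducible_semigroup T"
    using persistently_irreducible_iff[OF assms(3)] by simp
  ultimately show ?thesis by blast
qed

end
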